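(* Let $\beta\in(0,1/2^{|S|})$ and $\varepsilon\in\left(0,\frac{\beta(1-\beta)}{L\,|S|^{4}}\right)$, let $q$ be an irreducible transition matrix on $S$ and $\widehat q$ a transition matrix that is $(\varepsilon,\beta)$-close to $q$, and set $c=2|S|^2$. Then for every nonempty $C\subsetneq S$: (1) for every $s\in C$, $\max_{t\notin C}\left|\mathbf Q_{s,q}(t\mid C)-\mathbf Q_{s,\widehat q}(t\mid C)\right|<12\beta L$; (2) $\frac1c K_C\le \widehat K_C\le cK_C$.
   Context: $S$ is a finite set with $|S|\ge 2$. A transition matrix on $S$ is $q=(q(t\mid s))_{s,t\in S}$ with nonnegative entries and rows summing to $1$; $q(D\mid s)=\sum_{t\in D}q(t\mid s)$, $\overline C=S\setminus C$. For irreducible $q$, $\mu$ is its stationary distribution. $\zeta_q=\min_{\emptyset\neq C\subsetneq S}\sum_{s\in C}\mu_s q(\overline C\mid s)$. Given $\varepsilon,\beta>0$, $\widehat q$ is $(\varepsilon,\beta)$-close to $q$ if for all $s,t\in S$, $\left|1-\frac{\widehat q(t\mid s)}{q(t\mid s)}\right|\le\beta$ whenever (a) $\mu_s q(t\mid s)\ge\varepsilon\zeta_q$ or (b) $\mu_s\widehat q(t\mid s)\ge\varepsilon\zeta_q$ (in case (b) this requires $q(t\mid s)>0$). $L=\sum_{n=1}^{|S|-1}\binom{|S|}{n}n^{|S|}$. Let $(\mathbf s_n)_{n\ge0}$ be a Markov chain with transition matrix $q$, $\mathbf P_{s,q}$, $\mathbf E_{s,q}$ its law and expectation when $\mathbf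 s_0=s$; $T_D=\min\{n\ge0:\mathbf s_n\in D\}$. The exit distribution is $\mathbf Q_{s,q}(t\mid C)=\mathbf P_{s,q}(T_{\overline C}=T_{\{t\}})$ for $t\notin C$. For $s\in C$ let $\nu_C(s)=\frac{\sum_{t\in\overline C}\mu_t q(s\mid t)}{\sum_{t\in\overline C}\mu_t q(C\mid t)}$ and $K_C=\sum_{s\in C}\nu_C(s)\,\mathbf E_{s,q}[T_{\overline C}]$ (the average length of a visit to $C$). The quantities $\mathbf Q_{s,\widehat q}$, $\widehat K_C$ are defined in the same way with $\widehat q$ and its stationary distribution $\widehat\mu$ in place of $q$, $\mu$ ($\widehat q$ is irreducible under these hypotheses). *)

theory Defs
  imports "HOL-Analysis.Analysis"
begin

text \<open>State space: a finite type 'a (S = UNIV). A transition matrix is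
  q :: 'a \<Rightarrow> 'a \<Rightarrow> real with q s t = q(t | s).\<close>

definition trans_matrix :: "('a::finite \<Rightarrow> 'a \<Rightarrow> real) \<Rightarrow> bool" where
  "trans_matrix q \<longleftrightarrow> (\<forall>s t. 0 \<le> q s t) \<and> (\<forall>s. (\<Sum>t\<in>UNIV. q s t) = 1)"

fun mstep :: "('a::finite \<Rightarrow> 'a \<Rightarrow> real) \<Rightarrow> nat \<Rightarrow> 'a \<Rightarrow> 'a \<Rightarrow> real" where
  "mstep q 0 s t = (if s = t then 1 else 0)"
| "mstep q (Suc n) s t = (\<Sum>u\<in>UNIV. q s u * mstep q n u t)"

definition irreducible_tm :: "('a::finite \<Rightarrow> 'a \<Rightarrow> real) \<Rightarrow> bool" where
  "irreducible_tm q \<longleftrightarrow> (\<forall>s t. \<exists>n. 0 < mstep q n s t)"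

definition stationary :: "('a::finite \<Rightarrow> 'a \<Rightarrow> real) \<Rightarrow> ('a \<Rightarrow> real) \<Rightarrow> bool" where
  "stationary q \<mu> \<longleftrightarrow> (\<forall>s. 0 \<le> \<mu> s) \<and> (\<Sum>s\<in>UNIV. \<mu> s) = 1 \<and>
     (\<forall>t. (\<Sum>s\<in>UNIV. \<mu> s * q s t) = \<mu> t)"

text \<open>The (unique, for irreducible q) stationary distribution.\<close>
definition stat_dist :: "('a::finite \<Rightarrow> 'a \<Rightarrow> real) \<Rightarrow> 'a \<Rightarrow> real" where
  "stat_dist q = (THE \<mu>. stationary q \<mu>)"

definition qset :: "('a::finite \<Rightarrow> 'a \<Rightarrow> real) \<Rightarrow> 'a set \<Rightarrow> 'a \<Rightarrow> real" where
  "qset q D s = (\<Sum>t\<in>D. q s t)"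

definition zeta :: "('a::finite \<Rightarrow> 'a \<Rightarrow> real) \<Rightarrow> real" where
  "zeta q = Min ((\<lambda>C. \<Sum>s\<in>C. stat_dist q s * qset q (- C) s) ` {C. C \<noteq> {} \<and> C \<noteq> UNIV})"

definition close :: "real \<Rightarrow> real \<Rightarrow> ('a::finite \<Rightarrow> 'a \<Rightarrow> real) \<Rightarrow> ('a \<Rightarrow> 'a \<Rightarrow> real) \<Rightarrow> bool" where
  "close \<epsilon> \<beta> q qh \<longleftrightarrow> (\<forall>s t.
     (stat_dist q s * q s t \<ge> \<epsilon> * zeta q \<longrightarrow> \<bar>1 - qh s t / q s t\<bar> \<le> \<beta>) \<and>
     (stat_dist q s * qh s t \<ge> \<epsilon> * zeta q \<longrightarrow> q s t > 0 \<and> \<bar>1 - qh s t / q s t\<bar> \<le> \<beta>))"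

definition Lconst :: "'a::finite itself \<Rightarrow> real" where
  "Lconst _ = (\<Sum>n=1..CARD('a)-1. real (CARD('a) choose n) * real n ^ CARD('a))"

text \<open>exit_at q C n s t = P_s(T_{complement C} = n and s_n = t): the chain started at s
  stays in C at times 0..n-1 and is at t \<notin> C at time n.\<close>
fun exit_at :: "('a::finite \<Rightarrow> 'a \<Rightarrow> real) \<Rightarrow> 'a set \<Rightarrow> nat \<Rightarrow> 'a \<Rightarrow> 'a \<Rightarrow> real" where
  "exit_at q C 0 s t = (if s \<notin> C \<and> s = t then 1 else 0)"
| "exit_at q C (Suc n) s t = (if s \<in> C then (\<Sum>u\<in>UNIV. q s u * exit_at q C n u t) else 0)"

text \<open>Exit distribution Q_{s,q}(t | C) = P_s(T_{complement C} = T_{t}) = sum over n of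
  P_s(T_{complement C} = n, s_n = t).\<close>
definition exitQ :: "('a::finite \<Rightarrow> 'a \<Rightarrow> real) \<Rightarrow> 'a \<Rightarrow> 'a \<Rightarrow> 'a set \<Rightarrow> real" where
  "exitQ q s t C = (\<Sum>n. exit_at q C n s t)"

definition exp_exit_time :: "('a::finite \<Rightarrow> 'a \<Rightarrow> real) \<Rightarrow> 'a \<Rightarrow> 'a set \<Rightarrow> real" where
  "exp_exit_time q s C = (\<Sum>n. real n * (\<Sum>t\<in>UNIV. exit_at q C n s t))"

definition nu :: "('a::finite \<Rightarrow> 'a \<Rightarrow> real) \<Rightarrow> 'a set \<Rightarrow> 'a \<Rightarrow> real" where
  "nu q C s = (\<Sum>t\<in>-C. stat_dist q t * q t s) / (\<Sum>t\<in>-C. stat_dist q t * qset q C t)"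

definition Kvisit :: "('a::finite \<Rightarrow> 'a \<Rightarrow> real) \<Rightarrow> 'a set \<Rightarrow> real" where
  "Kvisit q C = (\<Sum>s\<in>C. nu q C s * exp_exit_time q s C)"

end

theory Submission
  imports Defs
begin

text \<open>
  Closeness gives \<open>\<mu> s * \<bar>qh s t - q s t\<bar> \<le> \<beta> * \<mu> s * q s t + \<epsilon> * \<zeta>\<close>. Since every cut
  carries \<open>\<mu>\<close>-flow at least \<open>\<zeta>\<close>, replacing any set of rows of \<open>q\<close> by those of \<open>qh\<close> changes
  all cut flows by factors \<open>1 \<plusminus> \<gamma>\<close> with \<open>\<gamma> = \<beta> + |S|^2 \<epsilon>\<close>, so in and out flows of a cut stay
  within \<open>\<rho> = (1 + \<gamma>) / (1 - \<gamma>)\<close> of each other. Balancing flow across the level sets of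
  \<open>\<mu>h / \<mu>\<close> bounds its oscillation by \<open>\<rho> ^ (|S| - 1)\<close>, and (2) follows because \<open>K_C\<close> is
  \<open>\<mu>(C)\<close> divided by the flow out of \<open>C\<close>. The same level set argument, applied to the Green
  function \<open>G s u\<close> of the chain killed on leaving \<open>C\<close>, bounds \<open>G s u / \<mu> u\<close> by a multiple of
  \<open>1 / \<zeta>\<close>. For (1) the rows are replaced one at a time: changing row \<open>u\<close> changes the exit
  probability \<open>f\<close> by \<open>G s u\<close> times the sum over \<open>w\<close> of the change of \<open>q u w\<close> times \<open>f w - f u\<close>.
  The relative part of the change costs at most \<open>\<beta>\<close>, since
  \<open>G u u * \<bar>f w - f u\<bar> \<le> G u u - G w u\<close> by the maximum principle and the \<open>q u\<close>-average of
  the right-hand side is \<open>1\<close>; the additive part is controlled by the bound on \<open>G s u / \<mu> u\<close>.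
\<close>

section \<open>Matrix inverses and elementary facts on transition matrices\<close>

text \<open>An injective square matrix has a left inverse, which is also a right inverse. Both
  identities are kept: for the Green function one becomes the first-step equation and the other the
  last-step equation.\<close>

lemma trivial_kernel_imp_inverse:
  fixes M :: "'a::finite \<Rightarrow> 'a \<Rightarrow> real"
  assumes "\<And>x. (\<And>s. (\<Sum>t\<in>UNIV. M s t * x t) = 0) \<Longrightarrow> x = (\<lambda>_. 0)"
  obtains G :: "'a \<Rightarrow> 'a \<Rightarrow> real"
  where "\<And>s u. (\<Sum>t\<in>UNIV. M s t * G t u) = (if s = u then 1 else 0)"
    and "\<And>s u. (\<Sum>t\<in>UNIV. G s t * M t u) = (if s = u then 1 else 0)"
proof -
  define A :: "real^'a^'a" where "A = (\<chi> s t. M s t)"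
  have "x = 0" if "A *v x = 0" for x
  proof -
    have "(\<Sum>t\<in>UNIV. M s t * x $ t) = 0" for s
      using arg_cong[OF that, of "\<lambda>v. v $ s"] by (simp add: A_def matrix_vector_mult_def)
    from assms[of "\<lambda>t. x $ t", OF this] show ?thesis
      by (auto simp: vec_eq_iff dest: fun_cong)
  qed
  then obtain B where BA: "B ** A = mat 1"
    using matrix_left_invertible_ker[of A] by blast
  then have AB: "A ** B = mat 1"
    using matrix_left_right_inverse by blast
  show ?thesis
  proof (rule that[of "\<lambda>s t. B $ s $ t"])
    fix s u
    show "(\<Sum>t\<in>UNIV. M s t * B $ t $ u) = (if s = u then 1 else 0)"
      using arg_cong[OF AB, of "\<lambda>v. v $ s $ u"] by (simp add: A_def matrix_matrix_mult_def mat_def)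
    show "(\<Sum>t\<in>UNIV. B $ s $ t * M t u) = (if s = u then 1 else 0)"
      using arg_cong[OF BA, of "\<lambda>v. v $ s $ u"] by (simp add: A_def matrix_matrix_mult_def mat_def)
  qed
qed

lemma trans_matrix_nonneg: "trans_matrix q \<Longrightarrow> 0 \<le> q s t"
  by (simp add: trans_matrix_def)

lemma trans_matrix_row_sum: "trans_matrix q \<Longrightarrow> (\<Sum>t\<in>UNIV. q s t) = 1"
  by (simp add: trans_matrix_def)

lemma trans_matrix_avg_const: "trans_matrix q \<Longrightarrow> (\<Sum>t\<in>UNIV. q s t * c) = c"
  by (simp add: trans_matrix_row_sum flip: sum_distrib_right)

lemma trans_matrix_avg_mono:
  "trans_matrix q \<Longrightarrow> (\<And>t. f t \<le> g t) \<Longrightarrow> (\<Sum>t\<in>UNIV. q s t * f t) \<le> (\<Sum>t\<in>UNIV. q s t * g t)"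
  by (intro sum_mono mult_left_mono trans_matrix_nonneg)

lemma sum_Compl_split:
  fixes f :: "'a::finite \<Rightarrow> real"
  shows "(\<Sum>s\<in>UNIV. f s) = (\<Sum>s\<in>D. f s) + (\<Sum>s\<in>-D. f s)"
  using sum.subset_diff[of D UNIV f] by (simp add: Compl_eq_Diff_UNIV)

lemma qset_Compl: "trans_matrix q \<Longrightarrow> qset q D s + qset q (- D) s = 1"
  unfolding qset_def using sum_Compl_split[of "q s" D] trans_matrix_row_sum[of q s] by simp

section \<open>Cut connectedness, maximum principle and Green function\<close>

text \<open>One-step form of irreducibility: no proper nonempty set is closed. It avoids iterates of
  \<open>q\<close>, so for a perturbed matrix it can be read off from positive cut flows.\<close>

definition cut_connected :: "('a::finite \<Rightarrow> 'a \<Rightarrow> real) \<Rightarrow> bool" where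
  "cut_connected q \<longleftrightarrow> (\<forall>D. D \<noteq> {} \<longrightarrow> D \<noteq> UNIV \<longrightarrow> (\<exists>s\<in>D. \<exists>t\<in>-D. 0 < q s t))"

text \<open>A set that cannot be left in one step cannot be left in \<open>n\<close> steps.\<close>

lemma irreducible_imp_cut_connected:
  assumes q: "trans_matrix q" and irr: "irreducible_tm q"
  shows "cut_connected q"
  unfolding cut_connected_def
proof (intro allI impI, rule ccontr)
  fix D :: "'a set"
  assume D: "D \<noteq> {}" "D \<noteq> UNIV" and "\<not> (\<exists>s\<in>D. \<exists>t\<in>-D. 0 < q s t)"
  then have 0: "q s t = 0" if "s \<in> D" "t \<notin> D" for s t
    using that trans_matrix_nonneg[OF q, of s t] by force
  have "\<forall>s\<in>D. \<forall>t\<in>-D. mstep q n s t = 0" for n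
  proof (induction n)
    case (Suc n)
    show ?case
    proof (intro ballI)
      fix s t assume "s \<in> D" "t \<in> -D"
      have "q s u * mstep q n u t = 0" for u
        using 0[of s u] Suc \<open>s \<in> D\<close> \<open>t \<in> -D\<close> by (cases "u \<in> D") auto
      then show "mstep q (Suc n) s t = 0" unfolding mstep.simps by (intro sum.neutral ballI)
    qed
  qed auto
  moreover obtain s t where "s \<in> D" "t \<in> -D" using D by auto
  moreover obtain n where "0 < mstep q n s t" using irr unfolding irreducible_tm_def by blast
  ultimately show False by (metis less_irrefl)
qed

text \<open>A positive maximum is attained only inside \<open>C\<close>; the cut condition supplies
  a transition from its level set \<open>D\<close> to a smaller value, so the average there falls
  strictly below the maximum.\<close>

lemma maximum_principle:
  fixes q :: "'a::finite \<Rightarrow> 'a \<Rightarrow> real"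
  assumes q: "trans_matrix q" and cut: "cut_connected q" and "C \<noteq> UNIV"
    and sub: "\<And>s. s \<in> C \<Longrightarrow> f s \<le> (\<Sum>u\<in>UNIV. q s u * f u)"
    and bdry: "\<And>s. s \<notin> C \<Longrightarrow> f s \<le> 0"
  shows "f s \<le> 0"
proof (rule ccontr)
  assume "\<not> f s \<le> 0"
  define M where "M = Max (range f)"
  have le: "f u \<le> M" for u unfolding M_def by simp
  have "M > 0" using le[of s] \<open>\<not> f s \<le> 0\<close> by linarith
  define D where "D = {u. f u = M}"
  have "M \<in> range f" unfolding M_def by (rule Max_in) auto
  then have "D \<noteq> {}" by (auto simp: D_def)
  have "D \<subseteq> C" using bdry \<open>M > 0\<close> unfolding D_def by force
  then have "D \<noteq> UNIV" using \<open>C \<noteq> UNIV\<close> by auto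
  then obtain u v where uv: "u \<in> D" "v \<in> -D" "0 < q u v"
    using cut \<open>D \<noteq> {}\<close> unfolding cut_connected_def by blast
  have "f v < M" using le[of v] uv(2) by (auto simp: D_def)
  have "(\<Sum>w\<in>UNIV. q u w * f w) < (\<Sum>w\<in>UNIV. q u w * M)"
  proof (rule sum_strict_mono_ex1)
    show "\<forall>w\<in>UNIV. q u w * f w \<le> q u w * M"
      using le trans_matrix_nonneg[OF q] by (auto intro: mult_left_mono)
    show "\<exists>w\<in>UNIV. q u w * f w < q u w * M"
      using uv(3) \<open>f v < M\<close> by (intro bexI[of _ v]) auto
  qed auto
  also have "\<dots> = M" by (rule trans_matrix_avg_const[OF q])
  finally show False using sub[of u] uv(1) \<open>D \<subseteq> C\<close> by (auto simp: D_def)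
qed

text \<open>The common source \<open>a\<close> cancels in the difference, to which the maximum
  principle applies in both signs. A nonzero source occurs in the resolvent identity of
  \<open>exitQ_row_change\<close>.\<close>

lemma harmonic_unique:
  fixes q :: "'a::finite \<Rightarrow> 'a \<Rightarrow> real"
  assumes "trans_matrix q" "cut_connected q" "C \<noteq> UNIV"
    and f: "\<And>s. s \<in> C \<Longrightarrow> f s = a s + (\<Sum>u\<in>UNIV. q s u * f u)"
    and g: "\<And>s. s \<in> C \<Longrightarrow> g s = a s + (\<Sum>u\<in>UNIV. q s u * g u)"
    and "\<And>s. s \<notin> C \<Longrightarrow> f s = g s"
  shows "f s = g s"
proof -
  have "f s - g s \<le> 0"
    by (rule maximum_principle[OF assms(1-3)])
      (use assms(6) f g in \<open>auto simp: algebra_simps sum_subtractf\<close>)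
  moreover have "g s - f s \<le> 0"
    by (rule maximum_principle[OF assms(1-3)])
      (use assms(6) f g in \<open>auto simp: algebra_simps sum_subtractf\<close>)
  ultimately show ?thesis by simp
qed

text \<open>\<open>G\<close> inverts the identity minus \<open>q\<close> with the rows outside
  \<open>C\<close> set to zero. For \<open>u\<close> in \<open>C\<close>, \<open>G s u\<close> is
  the expected number of visits to \<open>u\<close> before leaving \<open>C\<close>; for other
  \<open>u\<close> it is the probability of exiting at \<open>u\<close>. The first equation
  decomposes at the first step, the third at the last.\<close>

lemma green_exists:
  fixes q :: "'a::finite \<Rightarrow> 'a \<Rightarrow> real"
  assumes q: "trans_matrix q" "cut_connected q" and C: "C \<noteq> UNIV"
  obtains G :: "'a \<Rightarrow> 'a \<Rightarrow> real"
  where "\<And>s u. s \<in> C \<Longrightarrow> G s u = (if s = u then 1 else 0) + (\<Sum>v\<in>UNIV. q s v * G v u)"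
    and "\<And>s u. s \<notin> C \<Longrightarrow> G s u = (if s = u then 1 else 0)"
    and "\<And>s u. G s u = (if s = u then 1 else 0) + (\<Sum>v\<in>C. G s v * q v u)"
    and "\<And>s u. 0 \<le> G s u"
    and "\<And>s u. u \<in> C \<Longrightarrow> G s u \<le> G u u"
proof -
  define M where "M s t = (if s = t then 1 else 0) - (if s \<in> C then q s t else 0)" for s t
  have M_left: "(\<Sum>t\<in>UNIV. M s t * x t) = x s - (if s \<in> C then \<Sum>t\<in>UNIV. q s t * x t else 0)" for s x
  proof -
    have "(\<Sum>t\<in>UNIV. M s t * x t)
        = (\<Sum>t\<in>UNIV. (if s = t then x t else 0) - (if s \<in> C then q s t * x t else 0))"
      by (rule sum.cong) (auto simp: M_def algebra_simps)
    then show ?thesis by (simp add: sum_subtractf)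
  qed
  have M_right: "(\<Sum>t\<in>UNIV. x t * M t u) = x u - (\<Sum>t\<in>C. x t * q t u)" for u x
  proof -
    have "(\<Sum>t\<in>UNIV. x t * M t u)
        = (\<Sum>t\<in>UNIV. (if t = u then x t else 0) - (if t \<in> C then x t * q t u else 0))"
      by (rule sum.cong) (auto simp: M_def algebra_simps)
    then show ?thesis by (simp add: sum_subtractf sum.If_cases)
  qed
  have "x = (\<lambda>_. 0)" if x: "\<And>s. (\<Sum>t\<in>UNIV. M s t * x t) = 0" for x
  proof
    fix s
    show "x s = 0"
    proof (rule harmonic_unique[OF q C, where a = "\<lambda>_. 0"])
      show "x s = 0 + (\<Sum>u\<in>UNIV. q s u * x u)" if "s \<in> C" for s
        using x[of s] that unfolding M_left by simp
      show "x s = 0" if "s \<notin> C" for s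
        using x[of s] that unfolding M_left by simp
    qed simp
  qed
  then obtain G where G: "\<And>s u. (\<Sum>t\<in>UNIV. M s t * G t u) = (if s = u then 1 else 0)"
      "\<And>s u. (\<Sum>t\<in>UNIV. G s t * M t u) = (if s = u then 1 else 0)"
    by (rule trivial_kernel_imp_inverse[of M]) blast+
  have 1: "G s u = (if s = u then 1 else 0) + (\<Sum>v\<in>UNIV. q s v * G v u)" if "s \<in> C" for s u
    using G(1)[of s u] that unfolding M_left by (simp add: diff_eq_eq)
  have 2: "G s u = (if s = u then 1 else 0)" if "s \<notin> C" for s u
    using G(1)[of s u] that unfolding M_left by simp
  have 3: "G s u = (if s = u then 1 else 0) + (\<Sum>v\<in>C. G s v * q v u)" for s u
    using G(2)[of s u] unfolding M_right by (simp add: diff_eq_eq)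
  have 4: "0 \<le> G s u" for s u
  proof -
    have "- G s u \<le> 0"
    proof (rule maximum_principle[OF q C, of "\<lambda>s. - G s u"])
      show "- G s u \<le> (\<Sum>v\<in>UNIV. q s v * - G v u)" if "s \<in> C" for s
        using 1[OF that, of u] by (simp add: sum_negf split: if_splits)
    qed (simp add: 2)
    then show ?thesis by simp
  qed
  have 5: "G s u \<le> G u u" if "u \<in> C" for s u
  proof -
    have "G s u - G u u \<le> 0"
    \<comment> \<open>Away from \<open>u\<close> the unit source vanishes, so the difference is
      harmonic on \<open>C - {u}\<close>; it is zero at \<open>u\<close> and at most zero off
      \<open>C\<close>.\<close>
    proof (rule maximum_principle[OF q, of "C - {u}" "\<lambda>s. G s u - G u u"])
      show "C - {u} \<noteq> UNIV" by auto
      show "G s u - G u u \<le> (\<Sum>v\<in>UNIV. q s v * (G v u - G u u))" if "s \<in> C - {u}" for s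
        using 1[of s u] that trans_matrix_avg_const[OF q(1), of s "G u u"]
        by (simp add: algebra_simps sum_subtractf)
      show "G s u - G u u \<le> 0" if "s \<notin> C - {u}" for s
        using 2[of s u] 4[of u u] that \<open>u \<in> C\<close> by (cases "s = u") auto
    qed
    then show ?thesis by simp
  qed
  show ?thesis by (rule that[of G]) (fact 1 2 3 4 5)+
qed

section \<open>Stationary distributions: existence, positivity, uniqueness\<close>

text \<open>No normalisation is imposed, so that a nonnegative difference
  \<open>\<lambda>s. \<nu> s - c * \<mu> s\<close> of stationary distributions qualifies.\<close>

definition invariant_measure :: "('a::finite \<Rightarrow> 'a \<Rightarrow> real) \<Rightarrow> ('a \<Rightarrow> real) \<Rightarrow> bool" where
  "invariant_measure q v \<longleftrightarrow> (\<forall>s. 0 \<le> v s) \<and> (\<forall>t. (\<Sum>s\<in>UNIV. v s * q s t) = v t)"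

lemma stationary_imp_invariant: "stationary q \<mu> \<Longrightarrow> invariant_measure q \<mu>"
  by (simp add: stationary_def invariant_measure_def)

text \<open>The identity minus the transpose of \<open>q\<close> is singular. If \<open>x\<close> is
  in its kernel, the absolute value of \<open>x\<close> is pointwise at most its image under
  \<open>q\<close>; both have the same total mass, so they agree, and normalising gives a stationary
  distribution.\<close>

lemma stationary_exists:
  fixes q :: "'a::finite \<Rightarrow> 'a \<Rightarrow> real"
  assumes q: "trans_matrix q"
  obtains \<mu> where "stationary q \<mu>"
proof -
  define M where "M s t = (if s = t then 1 else 0) - q t s" for s t
  have M_left: "(\<Sum>t\<in>UNIV. M s t * x t) = x s - (\<Sum>t\<in>UNIV. x t * q t s)" for s x
  proof -
    have "(\<Sum>t\<in>UNIV. M s t * x t) = (\<Sum>t\<in>UNIV. (if s = t then x t else 0) - x t * q t s)"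
      by (rule sum.cong) (auto simp: M_def algebra_simps)
    then show ?thesis by (simp add: sum_subtractf)
  qed
  have "\<not> (\<forall>x. (\<forall>s. (\<Sum>t\<in>UNIV. M s t * x t) = 0) \<longrightarrow> x = (\<lambda>_. 0))"
  proof
    assume *: "\<forall>x. (\<forall>s. (\<Sum>t\<in>UNIV. M s t * x t) = 0) \<longrightarrow> x = (\<lambda>_. 0)"
    obtain G where G: "\<And>s u. (\<Sum>t\<in>UNIV. M s t * G t u) = (if s = u then 1 else 0)"
      by (rule trivial_kernel_imp_inverse[of M]) (use * in blast)+
    obtain u :: 'a where True by simp
    \<comment> \<open>Summed over \<open>s\<close>, column \<open>u\<close> of the product gives 1
      by invertibility, but 0 because the columns of \<open>M\<close> sum to zero.\<close>
    have "(\<Sum>s\<in>UNIV. \<Sum>t\<in>UNIV. M s t * G t u) = (1::real)"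
      by (simp add: G)
    moreover have "(\<Sum>s\<in>UNIV. \<Sum>t\<in>UNIV. M s t * G t u) = 0"
    proof -
      have "(\<Sum>s\<in>UNIV. M s t) = 0" for t
        by (simp add: M_def sum_subtractf trans_matrix_row_sum[OF q])
      then show ?thesis
        by (subst sum.swap) (simp flip: sum_distrib_right)
    qed
    ultimately show False by simp
  qed
  then obtain x where x: "\<And>s. x s = (\<Sum>t\<in>UNIV. x t * q t s)" "x \<noteq> (\<lambda>_. 0)"
    unfolding M_left by auto
  have le: "\<bar>x s\<bar> \<le> (\<Sum>t\<in>UNIV. \<bar>x t\<bar> * q t s)" for s
  proof -
    have "\<bar>x s\<bar> \<le> (\<Sum>t\<in>UNIV. \<bar>x t * q t s\<bar>)" by (subst x) (rule sum_abs)
    then show ?thesis by (simp add: abs_mult trans_matrix_nonneg[OF q])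
  qed
  have "(\<Sum>s\<in>UNIV. \<Sum>t\<in>UNIV. \<bar>x t\<bar> * q t s) = (\<Sum>s\<in>UNIV. \<bar>x s\<bar>)"
    by (subst sum.swap) (simp add: trans_matrix_row_sum[OF q] flip: sum_distrib_left)
  then have "(\<Sum>s\<in>UNIV. (\<Sum>t\<in>UNIV. \<bar>x t\<bar> * q t s) - \<bar>x s\<bar>) = 0"
    by (simp add: sum_subtractf)
  then have eq: "(\<Sum>t\<in>UNIV. \<bar>x t\<bar> * q t s) = \<bar>x s\<bar>" for s
    by (subst (asm) sum_nonneg_eq_0_iff) (use le in auto)
  define Z where "Z = (\<Sum>s\<in>UNIV. \<bar>x s\<bar>)"
  have "Z \<noteq> 0" unfolding Z_def using x(2) by (subst sum_nonneg_eq_0_iff) auto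
  moreover have "Z \<ge> 0" unfolding Z_def by (simp add: sum_nonneg)
  ultimately have "stationary q (\<lambda>s. \<bar>x s\<bar> / Z)"
    unfolding stationary_def
    by (auto simp: Z_def eq simp flip: sum_divide_distrib)
  then show ?thesis by (rule that)
qed

text \<open>The support is closed: a transition leaving it would carry mass to a state of measure
  zero.\<close>

lemma invariant_measure_pos:
  fixes q :: "'a::finite \<Rightarrow> 'a \<Rightarrow> real"
  assumes q: "trans_matrix q" "cut_connected q"
    and v: "invariant_measure q v" and "v u \<noteq> 0"
  shows "0 < v s"
proof (rule ccontr)
  assume "\<not> 0 < v s"
  have nn: "0 \<le> v s" and inv: "(\<Sum>s\<in>UNIV. v s * q s t) = v t" for s t
    using v by (auto simp: invariant_measure_def)
  define D where "D = {s. 0 < v s}"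
  have "u \<in> D" using nn[of u] \<open>v u \<noteq> 0\<close> by (simp add: D_def)
  moreover have "D \<noteq> UNIV" using \<open>\<not> 0 < v s\<close> by (auto simp: D_def)
  ultimately obtain a b where ab: "a \<in> D" "b \<in> -D" "0 < q a b"
    using q(2) unfolding cut_connected_def by blast
  have "v a * q a b \<le> (\<Sum>s\<in>UNIV. v s * q s b)"
    by (rule member_le_sum) (auto simp: nn trans_matrix_nonneg[OF q(1)])
  moreover have "0 < v a * q a b" using ab by (simp add: D_def)
  ultimately show False using ab(2) inv[of b] by (simp add: D_def)
qed

lemma stationary_pos:
  assumes "trans_matrix q" "cut_connected q" "stationary q \<mu>"
  shows "0 < \<mu> s"
proof -
  have "\<exists>u. \<mu> u \<noteq> 0"
    using assms(3) unfolding stationary_def by (metis sum.neutral zero_neq_one)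
  then show ?thesis
    using invariant_measure_pos[OF assms(1,2) stationary_imp_invariant[OF assms(3)]] by blast
qed

text \<open>Subtracting from \<open>\<nu>\<close> the largest multiple of \<open>\<mu>\<close> that
  keeps it nonnegative leaves an invariant measure with a zero, which vanishes identically;
  normalisation then gives \<open>c = 1\<close>.\<close>

lemma stationary_unique:
  fixes q :: "'a::finite \<Rightarrow> 'a \<Rightarrow> real"
  assumes q: "trans_matrix q" "cut_connected q"
    and \<mu>: "stationary q \<mu>" and \<nu>: "stationary q \<nu>"
  shows "\<mu> = \<nu>"
proof -
  have pos: "0 < \<mu> s" for s by (rule stationary_pos[OF q \<mu>])
  define c where "c = Min (range (\<lambda>s. \<nu> s / \<mu> s))"
  have c_le: "c \<le> \<nu> s / \<mu> s" for s unfolding c_def by simp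
  have "c \<in> range (\<lambda>s. \<nu> s / \<mu> s)" unfolding c_def by (rule Min_in) auto
  then obtain u where u: "c = \<nu> u / \<mu> u" by auto
  have inv: "invariant_measure q (\<lambda>s. \<nu> s - c * \<mu> s)"
    using \<mu> \<nu> c_le pos unfolding invariant_measure_def stationary_def
    by (auto simp: pos_le_divide_eq left_diff_distrib sum_subtractf mult.assoc
        simp flip: sum_distrib_left)
  have "\<nu> u - c * \<mu> u = 0" using u pos[of u] by (simp add: field_simps)
  then have eq: "\<nu> s = c * \<mu> s" for s
    using invariant_measure_pos[OF q inv, of s u] by fastforce
  have "1 = c" using \<mu> \<nu> unfolding stationary_def by (simp add: eq flip: sum_distrib_left)
  then show ?thesis using eq by auto
qed

lemma stationary_stat_dist:
  assumes "trans_matrix q" "cut_connected q"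
  shows "stationary q (stat_dist q)"
proof -
  obtain \<mu> where \<mu>: "stationary q \<mu>" using stationary_exists[OF assms(1)] .
  have "\<And>\<nu>. stationary q \<nu> \<Longrightarrow> \<nu> = \<mu>" by (rule stationary_unique[OF assms _ \<mu>])
  then show ?thesis
    unfolding stat_dist_def by (rule theI[of "stationary q", OF \<mu>])
qed

section \<open>Flows across cuts and level sets\<close>

text \<open>The weight \<open>w\<close> is free because flows are taken of stationary distributions,
  of a reference measure under a perturbed matrix, and of rows of a Green function.\<close>

definition flow :: "('a \<Rightarrow> real) \<Rightarrow> ('a::finite \<Rightarrow> 'a \<Rightarrow> real) \<Rightarrow> 'a set \<Rightarrow> 'a set \<Rightarrow> real" where
  "flow w q D E = (\<Sum>s\<in>D. w s * qset q E s)"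

lemma sum_inflow: "(\<Sum>t\<in>E. \<Sum>s\<in>D. w s * q s t) = flow w q D E"
  unfolding flow_def qset_def by (subst sum.swap) (simp add: sum_distrib_left)

text \<open>Here \<open>r\<close> is an external source entering the network.\<close>

lemma flow_balance:
  fixes q :: "'a::finite \<Rightarrow> 'a \<Rightarrow> real"
  assumes q: "trans_matrix q"
    and inv: "\<And>t. t \<in> D \<Longrightarrow> (\<Sum>s\<in>UNIV. w s * q s t) + r t = w t"
  shows "flow w q D (- D) = flow w q (- D) D + (\<Sum>t\<in>D. r t)"
proof -
  have "(\<Sum>t\<in>D. w t) = (\<Sum>t\<in>D. \<Sum>s\<in>UNIV. w s * q s t) + (\<Sum>t\<in>D. r t)"
    by (simp add: inv flip: sum.distrib)
  also have "(\<Sum>t\<in>D. \<Sum>s\<in>UNIV. w s * q s t) = flow w q D D + flow w q (- D) D"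
    by (subst sum_Compl_split[of _ D]) (simp add: sum.distrib sum_inflow)
  finally have "(\<Sum>t\<in>D. w t) = flow w q D D + flow w q (- D) D + (\<Sum>t\<in>D. r t)" .
  moreover have "(\<Sum>t\<in>D. w t) = flow w q D D + flow w q D (- D)"
    by (simp add: flow_def qset_Compl[OF q] flip: sum.distrib distrib_left)
  ultimately show ?thesis by simp
qed

lemma flow_mono:
  assumes "trans_matrix q" "\<And>s. s \<in> D \<Longrightarrow> v s \<le> w s"
  shows "flow v q D E \<le> flow w q D E"
  unfolding flow_def using assms
  by (intro sum_mono mult_right_mono) (auto simp: qset_def trans_matrix_nonneg intro!: sum_nonneg)

lemma flow_scale: "flow (\<lambda>s. c * w s) q D E = c * flow w q D E"
  by (simp add: flow_def sum_distrib_left mult.assoc)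

text \<open>Induction on the number of states where \<open>h\<close> exceeds \<open>h v\<close>: the cut condition bridges
  one gap between consecutive values of \<open>h\<close>.\<close>

lemma level_set_chain:
  fixes h :: "'a::finite \<Rightarrow> real"
  assumes "1 \<le> \<rho>" "0 \<le> \<kappa>" and nn: "\<And>s. 0 \<le> h s"
    and cut: "\<And>D x y. D \<noteq> {} \<Longrightarrow> D \<noteq> UNIV \<Longrightarrow> 0 \<le> x \<Longrightarrow> 0 \<le> y
      \<Longrightarrow> (\<And>s. s \<in> D \<Longrightarrow> x \<le> h s) \<Longrightarrow> (\<And>s. s \<notin> D \<Longrightarrow> h s \<le> y) \<Longrightarrow> x \<le> \<rho> * (y + \<kappa>)"
  shows "h a \<le> \<rho> ^ (CARD('a) - 1) * (h v + real (CARD('a) - 1) * \<kappa>)"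
proof -
  have step: "h a \<le> \<rho> ^ card {w. h v < h w} * (h v + real (card {w. h v < h w}) * \<kappa>)" for v
  proof (induction "card {w. h v < h w}" arbitrary: v rule: less_induct)
    case less
    define D where "D = {w. h v < h w}"
    show ?case
    proof (cases "D = {}")
      case True
      then have "h a \<le> h v" by (auto simp: D_def not_less)
      then show ?thesis using True by (simp add: D_def)
    next
      case False
      have "Min (h ` D) \<in> h ` D" by (rule Min_in) (use False in auto)
      then obtain w where w: "w \<in> D" "h w = Min (h ` D)" by force
      have w_le: "h w \<le> h s" if "s \<in> D" for s using w(2) that by simp
      define j where "j = card {s. h w < h s}"
      have "{s. h w < h s} \<subset> D" using w(1) by (auto simp: D_def)
      then have j: "Suc j \<le> card D" unfolding j_def Suc_le_eq by (intro psubset_card_mono) auto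
      have "h w \<le> \<rho> * (h v + \<kappa>)"
        by (rule cut[of D]) (use False w_le nn in \<open>auto simp: D_def\<close>)
      \<comment> \<open>The additive errors collected above \<open>w\<close> are absorbed by
        \<open>\<rho> \<ge> 1\<close>, so bridging one more gap costs one factor
        \<open>\<rho>\<close> and one \<open>\<kappa>\<close>.\<close>
      moreover have "real j * \<kappa> \<le> \<rho> * (real j * \<kappa>)"
        using mult_right_mono[OF \<open>1 \<le> \<rho>\<close>, of "real j * \<kappa>"] \<open>0 \<le> \<kappa>\<close> by simp
      ultimately have *: "h w + real j * \<kappa> \<le> \<rho> * (h v + real (Suc j) * \<kappa>)"
        by (simp add: algebra_simps)
      have "h a \<le> \<rho> ^ j * (h w + real j * \<kappa>)"
        using less[of w] j unfolding j_def D_def by simp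
      also have "\<dots> \<le> \<rho> ^ j * (\<rho> * (h v + real (Suc j) * \<kappa>))"
        by (rule mult_left_mono[OF *]) (use \<open>1 \<le> \<rho>\<close> in auto)
      also have "\<dots> = \<rho> ^ Suc j * (h v + real (Suc j) * \<kappa>)" by simp
      \<comment> \<open>Several states may share the value \<open>h w\<close>, so
        \<open>Suc j\<close> can be smaller than \<open>card D\<close>.\<close>
      also have "\<dots> \<le> \<rho> ^ card D * (h v + real (card D) * \<kappa>)"
        by (intro mult_mono power_increasing add_left_mono mult_right_mono)
          (use j nn assms(1,2) in auto)
      finally show ?thesis unfolding D_def .
    qed
  qed
  have le: "card {w. h v < h w} \<le> CARD('a) - 1"
  proof -
    have "{w. h v < h w} \<subset> UNIV" by auto
    then have "card {w. h v < h w} < CARD('a)" by (intro psubset_card_mono) auto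
    then show ?thesis by simp
  qed
  have "\<rho> ^ card {w. h v < h w} * (h v + real (card {w. h v < h w}) * \<kappa>)
      \<le> \<rho> ^ (CARD('a) - 1) * (h v + real (CARD('a) - 1) * \<kappa>)"
    by (intro mult_mono power_increasing add_left_mono mult_right_mono of_nat_mono le)
      (use nn assms(1,2) in auto)
  then show ?thesis using step[of v] by linarith
qed

section \<open>Exit laws, expected exit times and visit lengths\<close>

lemma exit_at_nonneg: "trans_matrix q \<Longrightarrow> 0 \<le> exit_at q C n s t"
  by (induction n arbitrary: s) (auto simp: trans_matrix_nonneg intro!: sum_nonneg mult_nonneg_nonneg)

lemma exit_at_cong:
  assumes "\<And>s. s \<in> C \<Longrightarrow> q s = q' s"
  shows "exit_at q C n s t = exit_at q' C n s t"
  using assms by (induction n arbitrary: s) auto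

text \<open>This is the law of the exit time: the probability that \<open>C\<close> is left exactly
  at time \<open>n\<close>.\<close>

definition exit_mass :: "('a::finite \<Rightarrow> 'a \<Rightarrow> real) \<Rightarrow> 'a set \<Rightarrow> nat \<Rightarrow> 'a \<Rightarrow> real" where
  "exit_mass q C n s = (\<Sum>t\<in>UNIV. exit_at q C n s t)"

lemma exit_mass_0: "exit_mass q C 0 s = (if s \<in> C then 0 else 1)"
  by (simp add: exit_mass_def)

lemma exit_mass_Suc:
  "exit_mass q C (Suc n) s = (if s \<in> C then \<Sum>u\<in>UNIV. q s u * exit_mass q C n u else 0)"
proof -
  have "(\<Sum>t\<in>UNIV. \<Sum>u\<in>UNIV. q s u * exit_at q C n u t) = (\<Sum>u\<in>UNIV. q s u * exit_mass q C n u)"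
    unfolding exit_mass_def by (subst sum.swap) (simp add: sum_distrib_left)
  then show ?thesis by (simp add: exit_mass_def)
qed

lemma exit_mass_nonneg: "trans_matrix q \<Longrightarrow> 0 \<le> exit_mass q C n s"
  by (simp add: exit_mass_def sum_nonneg exit_at_nonneg)

lemma exit_mass_partial_sum_le:
  assumes q: "trans_matrix q"
  shows "(\<Sum>n<M. exit_mass q C n s) \<le> 1"
proof (induction M arbitrary: s)
  case (Suc M)
  have split: "(\<Sum>n<Suc M. exit_mass q C n s) = exit_mass q C 0 s + (\<Sum>n<M. exit_mass q C (Suc n) s)"
    by (rule sum.lessThan_Suc_shift)
  show ?case
  proof (cases "s \<in> C")
    case True
    have "(\<Sum>n<M. exit_mass q C (Suc n) s) = (\<Sum>u\<in>UNIV. q s u * (\<Sum>n<M. exit_mass q C n u))"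
      using True by (simp add: exit_mass_Suc sum_distrib_left) (rule sum.swap)
    also have "\<dots> \<le> (\<Sum>u\<in>UNIV. q s u * 1)"
      by (rule trans_matrix_avg_mono[OF q]) (rule Suc)
    also have "\<dots> = 1" by (rule trans_matrix_avg_const[OF q])
    finally show ?thesis unfolding split using True by (simp add: exit_mass_0)
  next
    case False
    then show ?thesis unfolding split by (simp add: exit_mass_0 exit_mass_Suc)
  qed
qed simp

lemma exit_at_partial_sum_le:
  assumes q: "trans_matrix q"
  shows "(\<Sum>n<M. exit_at q C n s t) \<le> 1"
proof -
  have "(\<Sum>n<M. exit_at q C n s t) \<le> (\<Sum>n<M. exit_mass q C n s)"
    unfolding exit_mass_def by (intro sum_mono member_le_sum) (auto simp: exit_at_nonneg[OF q])
  then show ?thesis using exit_mass_partial_sum_le[OF q, where M = M and C = C and s = s] by linarith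
qed

lemma summable_exit_at: "trans_matrix q \<Longrightarrow> summable (\<lambda>n. exit_at q C n s t)"
  by (rule summableI_nonneg_bounded[where x = 1])
    (auto simp: exit_at_nonneg exit_at_partial_sum_le)

lemma exitQ_nonneg: "trans_matrix q \<Longrightarrow> 0 \<le> exitQ q s t C"
  unfolding exitQ_def by (intro suminf_nonneg summable_exit_at exit_at_nonneg)

lemma exitQ_le_1: "trans_matrix q \<Longrightarrow> exitQ q s t C \<le> 1"
  unfolding exitQ_def by (intro suminf_le_const summable_exit_at exit_at_partial_sum_le)

lemma exitQ_outside:
  assumes "s \<notin> C"
  shows "exitQ q s t C = (if s = t then 1 else 0)"
proof -
  have "exit_at q C n s t = 0" if "n \<noteq> 0" for n using assms that by (cases n) auto
  then have "exitQ q s t C = (\<Sum>n\<in>{0}. exit_at q C n s t)"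
    unfolding exitQ_def by (intro suminf_finite) auto
  then show ?thesis using assms by simp
qed

lemma exitQ_harmonic:
  assumes q: "trans_matrix q" and "s \<in> C"
  shows "exitQ q s t C = (\<Sum>u\<in>UNIV. q s u * exitQ q u t C)"
proof -
  have "exitQ q s t C = (\<Sum>n. exit_at q C (Suc n) s t)"
    unfolding exitQ_def using suminf_split_head[OF summable_exit_at[OF q, of C s t]] assms(2) by simp
  also have "\<dots> = (\<Sum>n. \<Sum>u\<in>UNIV. q s u * exit_at q C n u t)"
    using assms(2) by simp
  also have "\<dots> = (\<Sum>u\<in>UNIV. \<Sum>n. q s u * exit_at q C n u t)"
    by (intro suminf_sum summable_mult summable_exit_at q)
  also have "\<dots> = (\<Sum>u\<in>UNIV. q s u * exitQ q u t C)"
    unfolding exitQ_def by (simp add: suminf_mult summable_exit_at q)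
  finally show ?thesis .
qed

text \<open>The total exit probability and the constant 1 are both harmonic on \<open>C\<close> with
  boundary value 1.\<close>

lemma exit_mass_sums_1:
  fixes q :: "'a::finite \<Rightarrow> 'a \<Rightarrow> real"
  assumes q: "trans_matrix q" "cut_connected q" and C: "C \<noteq> UNIV"
  shows "(\<lambda>n. exit_mass q C n s) sums 1"
proof -
  have "(\<Sum>t\<in>UNIV. exitQ q s t C) = 1"
  proof (rule harmonic_unique[OF q C, where a = "\<lambda>_. 0"])
    show "(\<Sum>t\<in>UNIV. exitQ q s t C) = 0 + (\<Sum>u\<in>UNIV. q s u * (\<Sum>t\<in>UNIV. exitQ q u t C))"
      if "s \<in> C" for s
      unfolding exitQ_harmonic[OF q(1) that, abs_def] sum_distrib_left
      by (subst sum.swap) simp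
    show "(\<Sum>t\<in>UNIV. exitQ q s t C) = 1" if "s \<notin> C" for s
      by (simp add: exitQ_outside[OF that])
    show "1 = 0 + (\<Sum>u\<in>UNIV. q s u * 1)" for s
      by (simp add: trans_matrix_row_sum[OF q(1)])
  qed
  moreover have "(\<lambda>n. exit_mass q C n s) sums (\<Sum>t\<in>UNIV. exitQ q s t C)"
    unfolding exit_mass_def exitQ_def
    by (intro sums_sum summable_sums summable_exit_at q(1))
  ultimately show ?thesis by simp
qed

text \<open>The Green row sum \<open>e\<close> solves the same recursion and dominates every partial
  sum, which yields summability; the recursion for the series then follows by an index
  shift.\<close>

lemma exp_exit_time_eq:
  fixes q :: "'a::finite \<Rightarrow> 'a \<Rightarrow> real"
  assumes q: "trans_matrix q" "cut_connected q" and C: "C \<noteq> UNIV"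
  shows "s \<in> C \<Longrightarrow> exp_exit_time q s C = 1 + (\<Sum>u\<in>UNIV. q s u * exp_exit_time q u C)"
    and "s \<notin> C \<Longrightarrow> exp_exit_time q s C = 0"
proof -
  obtain G where G: "\<And>s u. s \<in> C \<Longrightarrow> G s u = (if s = u then 1 else 0) + (\<Sum>v\<in>UNIV. q s v * G v u)"
      "\<And>s u. 0 \<le> G s u"
    by (rule green_exists[OF q C]) blast
  define e where "e s = (\<Sum>u\<in>C. G s u)" for s
  have e_nonneg: "0 \<le> e s" for s by (simp add: e_def sum_nonneg G)
  have e_C: "e s = 1 + (\<Sum>v\<in>UNIV. q s v * e v)" if "s \<in> C" for s
  proof -
    have "e s = (\<Sum>u\<in>C. (if s = u then 1 else 0) + (\<Sum>v\<in>UNIV. q s v * G v u))"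
      unfolding e_def by (intro sum.cong refl G(1) that)
    also have "\<dots> = (\<Sum>u\<in>C. (if s = u then 1 else 0)) + (\<Sum>u\<in>C. \<Sum>v\<in>UNIV. q s v * G v u)"
      by (rule sum.distrib)
    also have "(\<Sum>u\<in>C. \<Sum>v\<in>UNIV. q s v * G v u) = (\<Sum>v\<in>UNIV. q s v * e v)"
      unfolding e_def sum_distrib_left by (rule sum.swap)
    finally show ?thesis using that by simp
  qed
  let ?y = "\<lambda>n s. real n * exit_mass q C n s"
  have y_nonneg: "0 \<le> ?y n s" for n s by (simp add: exit_mass_nonneg[OF q(1)])
  have "(\<Sum>n<M. ?y n s) \<le> e s" for M s
  proof (induction M arbitrary: s)
    case (Suc M)
    have split: "(\<Sum>n<Suc M. ?y n s) = (\<Sum>n<M. ?y (Suc n) s)"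
      by (subst sum.lessThan_Suc_shift) simp
    show ?case
    proof (cases "s \<in> C")
      case True
      \<comment> \<open>The weight \<open>n + 1\<close> splits into \<open>n\<close>, handled by
        induction, and 1, whose series is bounded by the total exit mass.\<close>
      have "(\<Sum>n<M. ?y (Suc n) s)
          = (\<Sum>n<M. \<Sum>u\<in>UNIV. q s u * (?y n u + exit_mass q C n u))"
        using True by (simp add: exit_mass_Suc sum_distrib_left algebra_simps)
      also have "\<dots> = (\<Sum>u\<in>UNIV. q s u * ((\<Sum>n<M. ?y n u) + (\<Sum>n<M. exit_mass q C n u)))"
        by (subst sum.swap) (simp add: sum.distrib flip: sum_distrib_left)
      also have "\<dots> \<le> (\<Sum>u\<in>UNIV. q s u * (e u + 1))"
        by (intro trans_matrix_avg_mono[OF q(1)] add_mono Suc exit_mass_partial_sum_le q)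
      also have "\<dots> = e s"
        using e_C[OF True] by (simp add: distrib_left sum.distrib trans_matrix_row_sum[OF q(1)])
      finally show ?thesis unfolding split .
    next
      case False
      then show ?thesis unfolding split by (simp add: exit_mass_Suc e_nonneg)
    qed
  qed (simp add: e_nonneg)
  then have summ: "summable (\<lambda>n. ?y n s)" for s
    by (intro summableI_nonneg_bounded[where x = "e s"] y_nonneg)
  have exp_eq: "exp_exit_time q s C = (\<Sum>n. ?y n s)" for s
    by (simp add: exp_exit_time_def exit_mass_def)
  have shift: "exp_exit_time q s C = (\<Sum>n. ?y (Suc n) s)" for s
    unfolding exp_eq using suminf_split_head[OF summ[of s]] by simp
  show "exp_exit_time q s C = 1 + (\<Sum>u\<in>UNIV. q s u * exp_exit_time q u C)" if "s \<in> C"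
  proof -
    have "?y (Suc n) s = (\<Sum>u\<in>UNIV. q s u * (?y n u + exit_mass q C n u))" for n
      using that by (simp add: exit_mass_Suc sum_distrib_left algebra_simps)
    moreover have "(\<lambda>n. \<Sum>u\<in>UNIV. q s u * (?y n u + exit_mass q C n u)) sums
        (\<Sum>u\<in>UNIV. q s u * (exp_exit_time q u C + 1))"
      unfolding exp_eq
      by (intro sums_sum sums_mult sums_add summable_sums summ exit_mass_sums_1 q C)
    ultimately have "exp_exit_time q s C = (\<Sum>u\<in>UNIV. q s u * (exp_exit_time q u C + 1))"
      unfolding shift[of s] by (simp add: sums_iff)
    then show ?thesis by (simp add: distrib_left sum.distrib trans_matrix_row_sum[OF q(1)])
  qed
  show "exp_exit_time q s C = 0" if "s \<notin> C"
    unfolding shift by (simp add: exit_mass_Suc that)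
qed

text \<open>A Kac-type formula: weighting the exit time recursion by the stationary distribution and
  summing over \<open>C\<close>, invariance leaves the inflow at each state of \<open>C\<close>,
  which is \<open>nu\<close> times its normaliser. That normaliser is the flow into
  \<open>C\<close>, equal to the flow out.\<close>

lemma Kvisit_eq:
  fixes q :: "'a::finite \<Rightarrow> 'a \<Rightarrow> real"
  assumes q: "trans_matrix q" "cut_connected q" and C: "C \<noteq> UNIV"
  shows "Kvisit q C = (\<Sum>s\<in>C. stat_dist q s) / flow (stat_dist q) q C (- C)"
proof -
  let ?\<mu> = "stat_dist q" and ?e = "\<lambda>s. exp_exit_time q s C"
  have inv: "(\<Sum>s\<in>UNIV. ?\<mu> s * q s t) = ?\<mu> t" for t
    using stationary_stat_dist[OF q] by (simp add: stationary_def)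
  have e: "1 = ?e s - (\<Sum>u\<in>C. q s u * ?e u)" if "s \<in> C" for s
    using exp_exit_time_eq(1)[OF q C that] sum_Compl_split[of "\<lambda>u. q s u * ?e u" C]
      exp_exit_time_eq(2)[OF q C] by simp
  have "(\<Sum>s\<in>C. ?\<mu> s) = (\<Sum>s\<in>C. ?\<mu> s * (?e s - (\<Sum>u\<in>C. q s u * ?e u)))"
    using e by simp
  also have "\<dots> = (\<Sum>u\<in>C. ?\<mu> u * ?e u) - (\<Sum>s\<in>C. \<Sum>u\<in>C. ?\<mu> s * q s u * ?e u)"
    by (simp add: right_diff_distrib sum_subtractf sum_distrib_left mult.assoc)
  also have "(\<Sum>s\<in>C. \<Sum>u\<in>C. ?\<mu> s * q s u * ?e u) = (\<Sum>u\<in>C. (\<Sum>s\<in>C. ?\<mu> s * q s u) * ?e u)"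
    by (subst sum.swap) (simp add: sum_distrib_right)
  also have "(\<Sum>u\<in>C. ?\<mu> u * ?e u) - \<dots> = (\<Sum>u\<in>C. (\<Sum>t\<in>-C. ?\<mu> t * q t u) * ?e u)"
  proof -
    have "(\<Sum>t\<in>-C. ?\<mu> t * q t u) = ?\<mu> u - (\<Sum>s\<in>C. ?\<mu> s * q s u)" for u
      using inv[of u] sum_Compl_split[of "\<lambda>s. ?\<mu> s * q s u" C] by simp
    then show ?thesis by (simp add: left_diff_distrib sum_subtractf)
  qed
  finally have "(\<Sum>u\<in>C. (\<Sum>t\<in>-C. ?\<mu> t * q t u) * ?e u) = (\<Sum>s\<in>C. ?\<mu> s)" ..
  moreover have "flow ?\<mu> q (- C) C = flow ?\<mu> q C (- C)"
    using flow_balance[OF q(1), of C ?\<mu> "\<lambda>_. 0"] inv by simp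
  ultimately show ?thesis
    by (simp add: Kvisit_def nu_def flow_def flip: sum_divide_distrib)
qed

section \<open>Reference measures that nearly balance every cut\<close>

text \<open>In the application \<open>\<mu>\<close> is the stationary distribution of the
  unperturbed matrix, not of \<open>q\<close>. The factor \<open>\<rho>\<close> measures the failure
  of balance, and \<open>z\<close> bounds every outflow from below up to that factor.\<close>

definition cut_balanced :: "('a \<Rightarrow> real) \<Rightarrow> ('a::finite \<Rightarrow> 'a \<Rightarrow> real) \<Rightarrow> real \<Rightarrow> real \<Rightarrow> bool" where
  "cut_balanced \<mu> q \<rho> z \<longleftrightarrow> (\<forall>D. D \<noteq> {} \<longrightarrow> D \<noteq> UNIV \<longrightarrow>
     flow \<mu> q (- D) D \<le> \<rho> * flow \<mu> q D (- D) \<and> z \<le> \<rho> * flow \<mu> q D (- D))"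

lemma cut_balanced_imp_cut_connected:
  fixes q :: "'a::finite \<Rightarrow> 'a \<Rightarrow> real"
  assumes q: "trans_matrix q" and bal: "cut_balanced \<mu> q \<rho> z" and z: "0 < z"
  shows "cut_connected q"
  unfolding cut_connected_def
proof (intro allI impI, rule ccontr)
  fix D :: "'a set"
  assume D: "D \<noteq> {}" "D \<noteq> UNIV" and "\<not> (\<exists>s\<in>D. \<exists>t\<in>-D. 0 < q s t)"
  then have "q s t = 0" if "s \<in> D" "t \<notin> D" for s t
    using that trans_matrix_nonneg[OF q, of s t] by force
  then have "flow \<mu> q D (- D) = 0" by (simp add: flow_def qset_def)
  moreover have "z \<le> \<rho> * flow \<mu> q D (- D)" using bal D unfolding cut_balanced_def by simp
  ultimately show False using z by simp
qed

text \<open>For a level set \<open>D\<close> inside \<open>C\<close>, the flow of \<open>w\<close>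
  out of \<open>D\<close> is the flow in plus at most a unit source. Comparing \<open>w\<close> with
  multiples of \<open>\<mu>\<close> gives the one-gap estimate with \<open>\<kappa> = 1 / z\<close>.
  Setting \<open>h\<close> to zero off \<open>C\<close> settles the other level sets and provides a
  base point of value zero.\<close>

lemma green_bound:
  fixes q :: "'a::finite \<Rightarrow> 'a \<Rightarrow> real"
  assumes q: "trans_matrix q" and bal: "cut_balanced \<mu> q \<rho> z"
    and z: "0 < z" and \<rho>: "1 \<le> \<rho>" and \<mu>: "\<And>s. 0 < \<mu> s" and C: "C \<noteq> UNIV"
    and G: "\<And>u. G u = (if s = u then 1 else 0) + (\<Sum>v\<in>C. G v * q v u)" "\<And>u. 0 \<le> G u"
    and "u \<in> C"
  shows "G u \<le> \<rho> ^ (CARD('a) - 1) * (real (CARD('a) - 1) / z) * \<mu> u"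
proof -
  define h where "h v = (if v \<in> C then G v / \<mu> v else 0)" for v
  define w where "w v = (if v \<in> C then G v else 0)" for v
  have w: "w v = h v * \<mu> v" for v using \<mu>[of v] by (simp add: w_def h_def)
  have h_nonneg: "0 \<le> h v" for v using \<mu>[of v] G(2)[of v] by (simp add: h_def)
  have w_eq: "(\<Sum>v\<in>UNIV. w v * q v t) + (if s = t then 1 else 0) = w t" if "t \<in> C" for t
  proof -
    have "(\<Sum>v\<in>UNIV. w v * q v t) = (\<Sum>v\<in>C. G v * q v t)"
      by (subst sum_Compl_split[of _ C]) (simp add: w_def)
    then show ?thesis using G(1)[of t] that by (simp add: w_def)
  qed
  obtain v where v: "v \<notin> C" using C by auto
  have "h u \<le> \<rho> ^ (CARD('a) - 1) * (h v + real (CARD('a) - 1) * (1 / z))"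
  proof (rule level_set_chain[OF \<rho> _ h_nonneg])
    fix D :: "'a set" and x y
    assume D: "D \<noteq> {}" "D \<noteq> UNIV" and xy: "0 \<le> x" "0 \<le> y"
      and lo: "\<And>t. t \<in> D \<Longrightarrow> x \<le> h t" and hi: "\<And>t. t \<notin> D \<Longrightarrow> h t \<le> y"
    show "x \<le> \<rho> * (y + 1 / z)"
    proof (cases "D \<subseteq> C")
      case False
      then obtain t where "t \<in> D" "t \<notin> C" by blast
      then have "x \<le> 0" using lo[of t] by (simp add: h_def)
      also have "0 \<le> \<rho> * (y + 1 / z)" using \<rho> xy z by simp
      finally show ?thesis .
    next
      case True
      let ?F = "flow \<mu> q D (- D)"
      have F: "flow \<mu> q (- D) D \<le> \<rho> * ?F" "z \<le> \<rho> * ?F"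
        using bal D unfolding cut_balanced_def by auto
      have "0 < \<rho> * ?F" using F(2) z by linarith
      then have F_pos: "0 < ?F" using \<rho> by (simp add: zero_less_mult_iff)
      have "x * ?F = flow (\<lambda>s. x * \<mu> s) q D (- D)" by (simp add: flow_scale)
      also have "\<dots> \<le> flow w q D (- D)"
        by (rule flow_mono[OF q]) (simp add: w lo \<mu> less_imp_le)
      also have "\<dots> = flow w q (- D) D + (\<Sum>t\<in>D. if s = t then 1 else 0)"
        by (rule flow_balance[OF q]) (use w_eq True in blast)
      also have "(\<Sum>t\<in>D. if s = t then 1 else 0) \<le> (1::real)" by simp
      also have "flow w q (- D) D \<le> flow (\<lambda>s. y * \<mu> s) q (- D) D"
        by (rule flow_mono[OF q]) (simp add: w hi \<mu> less_imp_le)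
      also have "\<dots> = y * flow \<mu> q (- D) D" by (simp add: flow_scale)
      also have "\<dots> \<le> y * (\<rho> * ?F)" by (rule mult_left_mono[OF F(1) xy(2)])
      \<comment> \<open>The unit source is bounded by a multiple of the cut flow, so that the
        estimate can be divided by \<open>?F\<close>.\<close>
      also have "1 \<le> \<rho> * ?F / z" using F(2) z by simp
      finally have "x * ?F \<le> (\<rho> * (y + 1 / z)) * ?F" by (simp add: algebra_simps)
      then show ?thesis using F_pos by simp
    qed
  qed (use z in simp)
  then show ?thesis using v \<open>u \<in> C\<close> \<mu>[of u] by (simp add: h_def field_simps)
qed

text \<open>The argument of \<open>green_bound\<close> without a source, hence with
  \<open>\<kappa> = 0\<close>.\<close>

lemma stationary_ratio_bound:
  fixes q :: "'a::finite \<Rightarrow> 'a \<Rightarrow> real"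
  assumes q: "trans_matrix q" and bal: "cut_balanced \<mu> q \<rho> z"
    and z: "0 < z" and \<rho>: "1 \<le> \<rho>" and \<mu>: "\<And>s. 0 < \<mu> s"
    and st: "stationary q \<nu>"
  shows "\<nu> a / \<mu> a \<le> \<rho> ^ (CARD('a) - 1) * (\<nu> v / \<mu> v)"
proof -
  define h where "h v = \<nu> v / \<mu> v" for v
  have \<nu>: "\<nu> v = h v * \<mu> v" for v using \<mu>[of v] by (simp add: h_def)
  have h_nonneg: "0 \<le> h v" for v using \<mu>[of v] st by (simp add: h_def stationary_def)
  have "h a \<le> \<rho> ^ (CARD('a) - 1) * (h v + real (CARD('a) - 1) * 0)"
  proof (rule level_set_chain[OF \<rho> _ h_nonneg])
    fix D :: "'a set" and x y
    assume D: "D \<noteq> {}" "D \<noteq> UNIV" and xy: "0 \<le> x" "0 \<le> y"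
      and lo: "\<And>t. t \<in> D \<Longrightarrow> x \<le> h t" and hi: "\<And>t. t \<notin> D \<Longrightarrow> h t \<le> y"
    let ?F = "flow \<mu> q D (- D)"
    have F: "flow \<mu> q (- D) D \<le> \<rho> * ?F" "z \<le> \<rho> * ?F"
      using bal D unfolding cut_balanced_def by auto
    have "0 < \<rho> * ?F" using F(2) z by linarith
    then have F_pos: "0 < ?F" using \<rho> by (simp add: zero_less_mult_iff)
    have "x * ?F = flow (\<lambda>s. x * \<mu> s) q D (- D)" by (simp add: flow_scale)
    also have "\<dots> \<le> flow \<nu> q D (- D)"
      by (rule flow_mono[OF q]) (simp add: \<nu> lo \<mu> less_imp_le)
    also have "\<dots> = flow \<nu> q (- D) D + (\<Sum>t\<in>D. 0)"
      by (rule flow_balance[OF q]) (use st in \<open>simp add: stationary_def\<close>)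
    also have "\<dots> \<le> flow (\<lambda>s. y * \<mu> s) q (- D) D"
      by (simp, rule flow_mono[OF q]) (simp add: \<nu> hi \<mu> less_imp_le)
    also have "\<dots> = y * flow \<mu> q (- D) D" by (simp add: flow_scale)
    also have "\<dots> \<le> y * (\<rho> * ?F)" by (rule mult_left_mono[OF F(1) xy(2)])
    finally have "x * ?F \<le> (\<rho> * (y + 0)) * ?F" by (simp add: algebra_simps)
    then show "x \<le> \<rho> * (y + 0)" using F_pos by simp
  qed simp
  then show ?thesis by (simp add: h_def)
qed

text \<open>The Green function enters \<open>H\<close> only through nonnegativity and its last-step
  equation, which is the form that \<open>green_bound\<close> accepts.\<close>

lemma exitQ_row_change:
  fixes q p :: "'a::finite \<Rightarrow> 'a \<Rightarrow> real"
  assumes q: "trans_matrix q" "cut_connected q" and p: "trans_matrix p"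
    and C: "C \<noteq> UNIV" and u: "u \<in> C"
    and same: "\<And>s. s \<noteq> u \<Longrightarrow> p s = q s"
    and diff: "\<And>w. \<bar>p u w - q u w\<bar> \<le> \<beta> * q u w + \<delta>" and "0 \<le> \<beta>" "0 \<le> \<delta>"
    and H: "\<And>G. (\<And>v. G v = (if s = v then 1 else 0) + (\<Sum>r\<in>C. G r * q r v)) \<Longrightarrow>
        (\<And>v. 0 \<le> G v) \<Longrightarrow> G u * \<delta> \<le> H"
  shows "\<bar>exitQ p s t C - exitQ q s t C\<bar> \<le> \<beta> + real CARD('a) * H"
proof -
  obtain G where G: "\<And>s u. s \<in> C \<Longrightarrow> G s u = (if s = u then 1 else 0) + (\<Sum>v\<in>UNIV. q s v * G v u)"
      "\<And>s u. s \<notin> C \<Longrightarrow> G s u = (if s = u then 1 else 0)"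
      "\<And>s u. G s u = (if s = u then 1 else 0) + (\<Sum>v\<in>C. G s v * q v u)"
      "\<And>s u. 0 \<le> G s u"
      "\<And>s u. u \<in> C \<Longrightarrow> G s u \<le> G u u"
    by (rule green_exists[OF q C]) blast
  define f where "f w = exitQ p w t C" for w
  have f01: "0 \<le> f w" "f w \<le> 1" for w
    by (simp_all add: f_def exitQ_nonneg exitQ_le_1 p)
  have f_harm: "f w = (\<Sum>v\<in>UNIV. p w v * f v)" if "w \<in> C" for w
    unfolding f_def by (rule exitQ_harmonic[OF p that])
  define c where "c = (\<Sum>w\<in>UNIV. (p u w - q u w) * f w)"
  \<comment> \<open>Relative to \<open>q\<close>, the function \<open>f\<close> is harmonic on
    \<open>C\<close> up to a source \<open>c\<close> at the changed row \<open>u\<close>.\<close>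
  have resolvent: "f s = exitQ q s t C + G s u * c" for s
  proof (rule harmonic_unique[OF q C, where a = "\<lambda>s. if s = u then c else 0"
        and f = f and g = "\<lambda>s. exitQ q s t C + G s u * c"])
    show "f s = (if s = u then c else 0) + (\<Sum>v\<in>UNIV. q s v * f v)" if "s \<in> C" for s
      using f_harm[OF that] same[of s]
      by (simp add: c_def left_diff_distrib sum_subtractf)
    show "exitQ q s t C + G s u * c = (if s = u then c else 0)
        + (\<Sum>v\<in>UNIV. q s v * (exitQ q v t C + G v u * c))" if "s \<in> C" for s
      using exitQ_harmonic[OF q(1) that, of t] G(1)[OF that, of u]
      by (simp add: distrib_left distrib_right sum.distrib sum_distrib_right mult.assoc)
    show "f s = exitQ q s t C + G s u * c" if "s \<notin> C" for s
      using that u by (auto simp: f_def exitQ_outside G(2))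
  qed
  \<comment> \<open>Both rows sum to 1, so \<open>f\<close> may be shifted by
    \<open>f u\<close>.\<close>
  have c_eq: "c = (\<Sum>w\<in>UNIV. (p u w - q u w) * (f w - f u))"
    using trans_matrix_avg_const[OF p, of u "f u"] trans_matrix_avg_const[OF q(1), of u "f u"]
    by (simp add: c_def algebra_simps sum_subtractf sum.distrib)
  \<comment> \<open>With a sign \<open>\<sigma>\<close> in place of the absolute value, both sides
    vanish at \<open>u\<close> and are harmonic on \<open>C - {u}\<close>. Off \<open>C\<close> the
    right side equals \<open>G u u\<close>, while \<open>f\<close> oscillates by at most 1.\<close>
  have osc: "G u u * \<bar>f w - f u\<bar> \<le> G u u - G w u" for w
  proof -
    have "\<sigma> * (G u u * (f w - f u)) - (G u u - G w u) \<le> 0" if \<sigma>: "\<sigma> = 1 \<or> \<sigma> = -1" for \<sigma> w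
    proof (rule maximum_principle[OF q, of "C - {u}" "\<lambda>w. \<sigma> * (G u u * (f w - f u)) - (G u u - G w u)"])
      show "C - {u} \<noteq> UNIV" by auto
      show "\<sigma> * (G u u * (f w - f u)) - (G u u - G w u)
          \<le> (\<Sum>v\<in>UNIV. q w v * (\<sigma> * (G u u * (f v - f u)) - (G u u - G v u)))"
        if "w \<in> C - {u}" for w
      proof -
        have "f w = (\<Sum>v\<in>UNIV. q w v * f v)" "G w u = (\<Sum>v\<in>UNIV. q w v * G v u)"
          using that f_harm[of w] same[of w] G(1)[of w u] by auto
        moreover have "(\<Sum>v\<in>UNIV. q w v * (\<sigma> * (G u u * (f v - f u)) - (G u u - G v u)))
            = \<sigma> * (G u u * ((\<Sum>v\<in>UNIV. q w v * f v) - (\<Sum>v\<in>UNIV. q w v * f u)))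
              - ((\<Sum>v\<in>UNIV. q w v * G u u) - (\<Sum>v\<in>UNIV. q w v * G v u))"
          by (simp add: algebra_simps sum_subtractf sum.distrib sum_distrib_left)
        ultimately show ?thesis by (simp only: trans_matrix_avg_const[OF q(1)])
      qed
      show "\<sigma> * (G u u * (f w - f u)) - (G u u - G w u) \<le> 0" if "w \<notin> C - {u}" for w
      proof (cases "w = u")
        case False
        then have "G w u = 0" using that G(2)[of w u] by auto
        moreover have "\<sigma> * (f w - f u) \<le> 1" using \<sigma> f01[of w] f01[of u] by auto
        then have "G u u * (\<sigma> * (f w - f u)) \<le> G u u * 1" by (rule mult_left_mono) (rule G(4))
        ultimately show ?thesis by (simp add: algebra_simps)
      qed simp
    qed
    from this[of 1 w] this[of "-1" w] show ?thesis
      by (cases "0 \<le> f w - f u") (auto simp: algebra_simps)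
  qed
  \<comment> \<open>The first-step equation at \<open>u\<close>: the average is 1 however large
    \<open>G u u\<close> is, so the relative error is not amplified.\<close>
  have sum1: "(\<Sum>w\<in>UNIV. q u w * (G u u - G w u)) = 1"
    using G(1)[OF u, of u] trans_matrix_avg_const[OF q(1), of u "G u u"]
    by (simp add: right_diff_distrib sum_subtractf)
  have term_le: "G s u * (\<bar>p u w - q u w\<bar> * \<bar>f w - f u\<bar>) \<le> \<beta> * (q u w * (G u u - G w u)) + H" for w
  proof -
    have "G s u * (\<bar>p u w - q u w\<bar> * \<bar>f w - f u\<bar>) \<le> G s u * ((\<beta> * q u w + \<delta>) * \<bar>f w - f u\<bar>)"
      by (intro mult_left_mono mult_right_mono diff G(4)) simp
    also have "\<dots> = (\<beta> * q u w) * (G s u * \<bar>f w - f u\<bar>) + (G s u * \<delta>) * \<bar>f w - f u\<bar>"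
      by (simp add: algebra_simps)
    also have "\<dots> \<le> (\<beta> * q u w) * (G u u - G w u) + (G s u * \<delta>) * 1"
    proof (intro add_mono mult_left_mono)
      have "G s u * \<bar>f w - f u\<bar> \<le> G u u * \<bar>f w - f u\<bar>"
        by (intro mult_right_mono G(5) u) simp
      then show "G s u * \<bar>f w - f u\<bar> \<le> G u u - G w u" using osc[of w] by linarith
      show "\<bar>f w - f u\<bar> \<le> 1" using f01[of w] f01[of u] by auto
    qed (use G(4) \<open>0 \<le> \<beta>\<close> \<open>0 \<le> \<delta>\<close> trans_matrix_nonneg[OF q(1)] in auto)
    also have "G s u * \<delta> \<le> H" by (rule H[OF G(3,4)])
    finally show ?thesis by (simp add: mult.assoc)
  qed
  have "\<bar>exitQ p s t C - exitQ q s t C\<bar> = G s u * \<bar>c\<bar>"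
    using resolvent[of s] G(4)[of s u] by (simp add: f_def abs_mult)
  also have "\<dots> \<le> G s u * (\<Sum>w\<in>UNIV. \<bar>p u w - q u w\<bar> * \<bar>f w - f u\<bar>)"
    unfolding c_eq by (intro mult_left_mono G(4) order_trans[OF sum_abs]) (simp add: abs_mult)
  also have "\<dots> \<le> (\<Sum>w\<in>UNIV. \<beta> * (q u w * (G u u - G w u)) + H)"
    unfolding sum_distrib_left by (intro sum_mono term_le)
  also have "\<dots> = \<beta> + real CARD('a) * H"
    by (simp add: sum.distrib sum1 flip: sum_distrib_left)
  finally show ?thesis .
qed

section \<open>Stability of cut flows, visit lengths and exit laws\<close>

lemma flow_perturbation:
  fixes q p :: "'a::finite \<Rightarrow> 'a \<Rightarrow> real"
  assumes near: "\<And>s t. \<mu> s * \<bar>p s t - q s t\<bar> \<le> \<beta> * (\<mu> s * q s t) + \<delta>"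
    and "0 \<le> \<delta>" and \<mu>: "\<And>s. 0 \<le> \<mu> s"
  shows "\<bar>flow \<mu> p D E - flow \<mu> q D E\<bar> \<le> \<beta> * flow \<mu> q D E + (real CARD('a))\<^sup>2 * \<delta>"
proof -
  have exp: "flow \<mu> r D E = (\<Sum>s\<in>D. \<Sum>t\<in>E. \<mu> s * r s t)" for r
    by (simp add: flow_def qset_def sum_distrib_left)
  have "\<bar>flow \<mu> p D E - flow \<mu> q D E\<bar> = \<bar>\<Sum>s\<in>D. \<Sum>t\<in>E. \<mu> s * (p s t - q s t)\<bar>"
    by (simp add: exp right_diff_distrib sum_subtractf)
  also have "\<dots> \<le> (\<Sum>s\<in>D. \<bar>\<Sum>t\<in>E. \<mu> s * (p s t - q s t)\<bar>)" by (rule sum_abs)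
  also have "\<dots> \<le> (\<Sum>s\<in>D. \<Sum>t\<in>E. \<mu> s * \<bar>p s t - q s t\<bar>)"
    by (intro sum_mono order_trans[OF sum_abs]) (simp add: abs_mult \<mu>)
  also have "\<dots> \<le> (\<Sum>s\<in>D. \<Sum>t\<in>E. \<beta> * (\<mu> s * q s t) + \<delta>)" by (intro sum_mono near)
  also have "\<dots> = \<beta> * flow \<mu> q D E + real (card D) * real (card E) * \<delta>"
    by (simp add: exp sum.distrib sum_distrib_left)
  also have "real (card D) * real (card E) * \<delta> \<le> real CARD('a) * real CARD('a) * \<delta>"
    by (intro mult_right_mono mult_mono) (auto simp: card_mono \<open>0 \<le> \<delta>\<close>)
  finally show ?thesis by (simp add: power2_eq_square)
qed

text \<open>Every cut flow of \<open>q\<close> is at least \<open>z\<close>, so the additive errors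
  of at most \<open>|S|^2\<close> entries become relative and merge with \<open>\<beta>\<close> into
  \<open>\<gamma>\<close>. Stationarity equates the two directions of a cut under \<open>q\<close>,
  which transfers to \<open>p\<close> up to \<open>\<rho>\<close>.\<close>

lemma cut_balanced_perturbation:
  fixes q p :: "'a::finite \<Rightarrow> 'a \<Rightarrow> real"
  assumes q: "trans_matrix q" and st: "stationary q \<mu>"
    and near: "\<And>s t. \<mu> s * \<bar>p s t - q s t\<bar> \<le> \<beta> * (\<mu> s * q s t) + \<epsilon> * z"
    and z: "0 < z" "\<And>D. D \<noteq> {} \<Longrightarrow> D \<noteq> UNIV \<Longrightarrow> z \<le> flow \<mu> q D (- D)"
    and \<epsilon>: "0 \<le> \<epsilon>" and \<gamma>: "\<gamma> = \<beta> + (real CARD('a))\<^sup>2 * \<epsilon>" "0 \<le> \<gamma>" "\<gamma> < 1"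
    and \<rho>: "\<rho> = (1 + \<gamma>) / (1 - \<gamma>)"
  shows "cut_balanced \<mu> p \<rho> z"
    and "\<lbrakk>D \<noteq> {}; D \<noteq> UNIV\<rbrakk> \<Longrightarrow> flow \<mu> p D (- D) \<le> \<rho> * flow \<mu> q D (- D)"
    and "\<lbrakk>D \<noteq> {}; D \<noteq> UNIV\<rbrakk> \<Longrightarrow> flow \<mu> q D (- D) \<le> \<rho> * flow \<mu> p D (- D)"
proof -
  have \<mu>: "0 \<le> \<mu> s" for s using st by (simp add: stationary_def)
  have \<rho>_ge: "1 / (1 - \<gamma>) \<le> \<rho>" "1 + \<gamma> \<le> \<rho>"
    using \<gamma>(2,3) unfolding \<rho> by (auto simp: field_simps)
  have near_flow: "(1 - \<gamma>) * flow \<mu> q D (- D) \<le> flow \<mu> p D (- D)"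
      "flow \<mu> p D (- D) \<le> (1 + \<gamma>) * flow \<mu> q D (- D)" if D: "D \<noteq> {}" "D \<noteq> UNIV" for D
  proof -
    let ?F = "flow \<mu> q D (- D)"
    have "\<bar>flow \<mu> p D (- D) - ?F\<bar> \<le> \<beta> * ?F + (real CARD('a))\<^sup>2 * (\<epsilon> * z)"
      by (rule flow_perturbation[OF near]) (use \<epsilon> z \<mu> in auto)
    also have "(real CARD('a))\<^sup>2 * (\<epsilon> * z) \<le> (real CARD('a))\<^sup>2 * (\<epsilon> * ?F)"
      by (intro mult_left_mono z(2) D \<epsilon>) auto
    finally have "\<bar>flow \<mu> p D (- D) - ?F\<bar> \<le> \<gamma> * ?F" by (simp add: \<gamma>(1) algebra_simps)
    then show "(1 - \<gamma>) * ?F \<le> flow \<mu> p D (- D)" "flow \<mu> p D (- D) \<le> (1 + \<gamma>) * ?F"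
      by (auto simp: algebra_simps)
  qed
  have le1: "flow \<mu> p D (- D) \<le> \<rho> * flow \<mu> q D (- D)"
    and le2: "flow \<mu> q D (- D) \<le> \<rho> * flow \<mu> p D (- D)"
    and le3: "flow \<mu> p (- D) D \<le> \<rho> * flow \<mu> p D (- D)"
    if D: "D \<noteq> {}" "D \<noteq> UNIV" for D
  proof -
    let ?F = "flow \<mu> q D (- D)"
    have F: "0 \<le> ?F" using z(1) z(2)[OF D] by linarith
    have p: "?F \<le> flow \<mu> p D (- D) / (1 - \<gamma>)"
      using near_flow(1)[OF D] \<gamma>(3) by (simp add: pos_le_divide_eq mult.commute)
    have p_nonneg: "0 \<le> flow \<mu> p D (- D)"
      using near_flow(1)[OF D] F \<gamma>(3) by (meson diff_ge_0_iff_ge less_imp_le mult_nonneg_nonneg order_trans)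
    show "flow \<mu> p D (- D) \<le> \<rho> * ?F"
      using near_flow(2)[OF D] mult_right_mono[OF \<rho>_ge(2) F] by linarith
    show "?F \<le> \<rho> * flow \<mu> p D (- D)"
      using p mult_right_mono[OF \<rho>_ge(1) p_nonneg] by simp
    have "flow \<mu> q (- D) D = ?F"
      using flow_balance[OF q, of D \<mu> "\<lambda>_. 0"] st by (simp add: stationary_def)
    \<comment> \<open>This is the upper estimate for the cut \<open>- D\<close>, whose outflow under
      \<open>q\<close> is also \<open>?F\<close>.\<close>
    then have "flow \<mu> p (- D) D \<le> (1 + \<gamma>) * ?F"
      using near_flow(2)[of "- D"] D by auto
    also have "\<dots> \<le> (1 + \<gamma>) * (flow \<mu> p D (- D) / (1 - \<gamma>))"
      by (rule mult_left_mono[OF p]) (use \<gamma>(2) in simp)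
    also have "\<dots> = \<rho> * flow \<mu> p D (- D)" by (simp add: \<rho>)
    finally show "flow \<mu> p (- D) D \<le> \<rho> * flow \<mu> p D (- D)" .
  qed
  show "cut_balanced \<mu> p \<rho> z"
    unfolding cut_balanced_def using le2 le3 z(2) by (meson order_trans)
  show "\<lbrakk>D \<noteq> {}; D \<noteq> UNIV\<rbrakk> \<Longrightarrow> flow \<mu> p D (- D) \<le> \<rho> * flow \<mu> q D (- D)" by (rule le1)
  show "\<lbrakk>D \<noteq> {}; D \<noteq> UNIV\<rbrakk> \<Longrightarrow> flow \<mu> q D (- D) \<le> \<rho> * flow \<mu> p D (- D)" by (rule le2)
qed

text \<open>In use, \<open>m\<close> and \<open>m'\<close> are the masses of \<open>C\<close> under
  the old and new stationary distributions, \<open>f\<close> and \<open>f'\<close> the flows of the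
  old one out of \<open>C\<close> under the old and new matrix, and \<open>g\<close> that of the new
  one under the new matrix; \<open>a\<close> and \<open>b\<close> are the extreme density values.
  The two visit lengths are \<open>m / f\<close> and \<open>m' / g\<close>.\<close>

lemma visit_ratio_bound:
  fixes a b m m' f f' g R \<rho> :: real
  assumes "0 < a" "b \<le> R * a" and m: "a * m \<le> m'" "m' \<le> b * m"
    and g: "a * f' \<le> g" "g \<le> b * f'" and f: "f' \<le> \<rho> * f" "f \<le> \<rho> * f'"
    and pos: "0 < m" "0 < f" "0 < f'" "1 \<le> R" "1 \<le> \<rho>"
  shows "m' / g \<le> (R * \<rho>) * (m / f)" "m / f \<le> (R * \<rho>) * (m' / g)"
proof -
  have g_pos: "0 < g" using g(1) \<open>0 < a\<close> pos(3) by (meson less_le_trans mult_pos_pos)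
  have "m' \<le> R * a * m" using m(2) mult_right_mono[OF assms(2), of m] pos by linarith
  then have "m' * f \<le> (R * a * m) * (\<rho> * f')"
    using f(2) pos \<open>0 < a\<close> by (intro mult_mono) auto
  also have "\<dots> = (R * \<rho> * m) * (a * f')" by (simp add: algebra_simps)
  also have "\<dots> \<le> (R * \<rho> * m) * g" by (rule mult_left_mono[OF g(1)]) (use pos in auto)
  finally show "m' / g \<le> (R * \<rho>) * (m / f)"
    using g_pos pos by (simp add: field_simps)
  have "g \<le> R * a * (\<rho> * f)"
  proof -
    have "b * f' \<le> R * a * f'" using mult_right_mono[OF assms(2), of f'] pos by simp
    also have "\<dots> \<le> R * a * (\<rho> * f)" by (rule mult_left_mono[OF f(1)]) (use pos \<open>0 < a\<close> in auto)
    finally show ?thesis using g(2) by linarith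
  qed
  then have "m * g \<le> m * (R * a * (\<rho> * f))" using pos by simp
  also have "\<dots> = (R * \<rho> * f) * (a * m)" by (simp add: algebra_simps)
  also have "\<dots> \<le> (R * \<rho> * f) * m'" by (rule mult_left_mono[OF m(1)]) (use pos in auto)
  finally show "m / f \<le> (R * \<rho>) * (m' / g)"
    using g_pos pos by (simp add: field_simps)
qed

text \<open>All but one of the factors \<open>\<rho>\<close> come from the oscillation of the
  density between the stationary distributions, the last from comparing the flows of one measure
  under both matrices.\<close>

lemma Kvisit_perturbation:
  fixes q p :: "'a::finite \<Rightarrow> 'a \<Rightarrow> real"
  assumes q: "trans_matrix q" "cut_connected q" and p: "trans_matrix p"
    and bal: "cut_balanced (stat_dist q) p \<rho> z" and z: "0 < z" and \<rho>: "1 \<le> \<rho>"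
    and C: "C \<noteq> {}" "C \<noteq> UNIV"
    and f: "0 < flow (stat_dist q) q C (- C)"
      "flow (stat_dist q) p C (- C) \<le> \<rho> * flow (stat_dist q) q C (- C)"
      "flow (stat_dist q) q C (- C) \<le> \<rho> * flow (stat_dist q) p C (- C)"
  shows "Kvisit p C \<le> \<rho> ^ CARD('a) * Kvisit q C"
    and "Kvisit q C \<le> \<rho> ^ CARD('a) * Kvisit p C"
proof -
  define \<mu> where "\<mu> = stat_dist q"
  define \<nu> where "\<nu> = stat_dist p"
  have cutp: "cut_connected p" by (rule cut_balanced_imp_cut_connected[OF p bal z])
  have stp: "stationary p \<nu>" unfolding \<nu>_def by (rule stationary_stat_dist[OF p cutp])
  have \<mu>: "0 < \<mu> s" for s unfolding \<mu>_def by (rule stationary_pos[OF q stationary_stat_dist[OF q]])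
  have \<nu>: "0 < \<nu> s" for s by (rule stationary_pos[OF p cutp stp])
  define h where "h s = \<nu> s / \<mu> s" for s
  define a where "a = Min (range h)"
  define b where "b = Max (range h)"
  have "a \<in> range h" unfolding a_def by (rule Min_in) auto
  then obtain v where v: "a = h v" by auto
  have "b \<in> range h" unfolding b_def by (rule Max_in) auto
  then obtain w where w: "b = h w" by auto
  have bounds: "a * \<mu> s \<le> \<nu> s" "\<nu> s \<le> b * \<mu> s" for s
  proof -
    have "a \<le> h s" "h s \<le> b" by (auto simp: a_def b_def)
    then show "a * \<mu> s \<le> \<nu> s" "\<nu> s \<le> b * \<mu> s"
      using \<mu>[of s] by (auto simp: h_def pos_le_divide_eq pos_divide_le_eq)
  qed
  have "0 < a" unfolding v h_def using \<mu> \<nu> by simp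
  have ba: "b \<le> \<rho> ^ (CARD('a) - 1) * a"
    unfolding v w h_def by (rule stationary_ratio_bound[OF p bal[folded \<mu>_def] z \<rho> \<mu> stp])
  have f': "0 < flow \<mu> p C (- C)"
  proof -
    have "0 < \<rho> * flow \<mu> p C (- C)" using f(1,3) unfolding \<mu>_def by linarith
    then show ?thesis using \<rho> by (simp add: zero_less_mult_iff)
  qed
  have mC: "0 < (\<Sum>s\<in>C. \<mu> s)" by (rule sum_pos) (use C \<mu> in auto)
  have m: "a * (\<Sum>s\<in>C. \<mu> s) \<le> (\<Sum>s\<in>C. \<nu> s)" "(\<Sum>s\<in>C. \<nu> s) \<le> b * (\<Sum>s\<in>C. \<mu> s)"
    unfolding sum_distrib_left by (intro sum_mono bounds)+
  have g: "a * flow \<mu> p C (- C) \<le> flow \<nu> p C (- C)" "flow \<nu> p C (- C) \<le> b * flow \<mu> p C (- C)"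
    unfolding flow_scale[symmetric] by (intro flow_mono p bounds)+
  have pow: "\<rho> ^ CARD('a) = \<rho> ^ (CARD('a) - 1) * \<rho>"
    by (simp flip: power_Suc2)
  have R: "1 \<le> \<rho> ^ (CARD('a) - 1)" using \<rho> by (rule one_le_power)
  note * = visit_ratio_bound[OF \<open>0 < a\<close> ba m g f(2,3)[folded \<mu>_def] mC f(1)[folded \<mu>_def] f' R \<rho>]
  show "Kvisit p C \<le> \<rho> ^ CARD('a) * Kvisit q C" "Kvisit q C \<le> \<rho> ^ CARD('a) * Kvisit p C"
    unfolding Kvisit_eq[OF q C(2)] Kvisit_eq[OF p cutp C(2)] pow using *
    by (simp_all only: \<mu>_def \<nu>_def)
qed

text \<open>All mixed matrices share the balance constants, so each row replacement costs the same.
  In the Green bound, \<open>1 / z\<close> and \<open>\<mu> u\<close> cancel against the additive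
  error \<open>\<epsilon> * z / \<mu> u\<close>.\<close>

lemma exitQ_perturbation:
  fixes q p :: "'a::finite \<Rightarrow> 'a \<Rightarrow> real"
  assumes q: "trans_matrix q" and p: "trans_matrix p" and C: "C \<noteq> UNIV"
    and \<mu>: "\<And>s. 0 < \<mu> s" and z: "0 < z" and \<rho>: "1 \<le> \<rho>" and \<beta>: "0 \<le> \<beta>" and \<epsilon>: "0 \<le> \<epsilon>"
    and near: "\<And>s t. \<mu> s * \<bar>p s t - q s t\<bar> \<le> \<beta> * (\<mu> s * q s t) + \<epsilon> * z"
    and bal: "\<And>A. cut_balanced \<mu> (\<lambda>s. if s \<in> A then p s else q s) \<rho> z"
  shows "\<bar>exitQ p s t C - exitQ q s t C\<bar>
    \<le> real (card C) * (\<beta> + real CARD('a) * (\<rho> ^ (CARD('a) - 1) * real (CARD('a) - 1) * \<epsilon>))"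
    (is "_ \<le> _ * ?B")
proof -
  let ?r = "\<lambda>A s. if s \<in> A then p s else q s"
  let ?H = "\<rho> ^ (CARD('a) - 1) * real (CARD('a) - 1) * \<epsilon>"
  have r: "trans_matrix (?r A)" for A using p q by (auto simp: trans_matrix_def)
  have "A \<subseteq> C \<Longrightarrow> \<bar>exitQ (?r A) s t C - exitQ q s t C\<bar> \<le> real (card A) * ?B"
    for A :: "'a set"
  proof (induction A rule: finite_induct[OF finite])
    case 1
    then show ?case by simp
  next
    case (2 u A)
    have "\<bar>exitQ (?r (insert u A)) s t C - exitQ (?r A) s t C\<bar> \<le> \<beta> + real CARD('a) * ?H"
    proof (rule exitQ_row_change[OF r cut_balanced_imp_cut_connected[OF r bal z] r C,
          where u = u and \<delta> = "\<epsilon> * z / \<mu> u"])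
      show "u \<in> C" using 2 by simp
      show "?r (insert u A) s = ?r A s" if "s \<noteq> u" for s using that by simp
      \<comment> \<open>Since \<open>u\<close> is not in \<open>A\<close>, row \<open>u\<close> of
        \<open>?r A\<close> is still that of \<open>q\<close>, and \<open>near\<close> is divided by
        \<open>\<mu> u\<close>.\<close>
      show "\<bar>?r (insert u A) u w - ?r A u w\<bar> \<le> \<beta> * ?r A u w + \<epsilon> * z / \<mu> u" for w
        using near[of u w] \<mu>[of u] 2(2) by (simp add: field_simps)
      show "G u * (\<epsilon> * z / \<mu> u) \<le> ?H"
        if G: "\<And>v. G v = (if s = v then 1 else 0) + (\<Sum>r\<in>C. G r * ?r A r v)" "\<And>v. 0 \<le> G v" for G
      proof -
        have "G u \<le> \<rho> ^ (CARD('a) - 1) * (real (CARD('a) - 1) / z) * \<mu> u"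
          by (rule green_bound[OF r bal z \<rho> \<mu> C G \<open>u \<in> C\<close>])
        then have "G u * (\<epsilon> * z / \<mu> u)
            \<le> (\<rho> ^ (CARD('a) - 1) * (real (CARD('a) - 1) / z) * \<mu> u) * (\<epsilon> * z / \<mu> u)"
          by (rule mult_right_mono) (use \<epsilon> z \<mu>[of u] in simp)
        also have "\<dots> = ?H" using z \<mu>[of u] by (simp add: field_simps)
        finally show ?thesis .
      qed
    qed (use \<beta> \<epsilon> z \<mu>[of u] in auto)
    moreover have "real (card (insert u A)) * ?B = real (card A) * ?B + ?B"
      using 2 by (simp add: distrib_right)
    ultimately show ?case using 2 by simp linarith
  qed
  from this[of C] have "\<bar>exitQ (?r C) s t C - exitQ q s t C\<bar>
      \<le> real (card C) * (\<beta> + real CARD('a) * ?H)" by simp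
  moreover have "exitQ (?r C) s t C = exitQ p s t C"
    unfolding exitQ_def by (simp add: exit_at_cong[of C "?r C" p])
  ultimately show ?thesis by simp
qed

section \<open>Consequences of closeness and numerical constants\<close>

text \<open>If either weighted entry reaches the threshold, the entries are relatively close; if
  both lie below it, so does the weighted difference of these nonnegative numbers.\<close>

lemma close_imp_near:
  assumes q: "trans_matrix q" "trans_matrix p" and cl: "close \<epsilon> \<beta> q p"
    and \<mu>: "0 < stat_dist q s" and "0 < \<epsilon> * zeta q" "0 \<le> \<beta>"
  shows "stat_dist q s * \<bar>p s t - q s t\<bar> \<le> \<beta> * (stat_dist q s * q s t) + \<epsilon> * zeta q"
proof -
  let ?m = "stat_dist q s"
  have nn: "0 \<le> q s t" "0 \<le> p s t" using q by (auto simp: trans_matrix_nonneg)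
  show ?thesis
  proof (cases "\<epsilon> * zeta q \<le> ?m * q s t \<or> \<epsilon> * zeta q \<le> ?m * p s t")
    case True
    \<comment> \<open>Clearing the quotient needs a positive denominator: a large weighted
      \<open>q s t\<close> is positive because the threshold is, and the other case of closeness
      includes positivity.\<close>
    have "0 < q s t \<and> \<bar>1 - p s t / q s t\<bar> \<le> \<beta>"
    proof (cases "\<epsilon> * zeta q \<le> ?m * q s t")
      case 1: True
      then have "0 < ?m * q s t" using assms(5) by linarith
      then show ?thesis using 1 cl \<mu> by (auto simp: close_def zero_less_mult_iff)
    qed (use True cl in \<open>auto simp: close_def\<close>)
    then have "\<bar>q s t * (1 - p s t / q s t)\<bar> \<le> q s t * \<beta>" "0 < q s t"
      by (auto simp: abs_mult)
    then have "\<bar>p s t - q s t\<bar> \<le> \<beta> * q s t" by (simp add: algebra_simps abs_minus_commute)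
    then have "?m * \<bar>p s t - q s t\<bar> \<le> ?m * (\<beta> * q s t)" using \<mu> by simp
    then show ?thesis using assms(5) by (simp add: algebra_simps)
  next
    case False
    have "?m * \<bar>p s t - q s t\<bar> \<le> ?m * max (p s t) (q s t)"
      using \<mu> nn by (intro mult_left_mono) auto
    also have "\<dots> \<le> \<epsilon> * zeta q" using False by (auto simp: max_def)
    also have "\<dots> \<le> \<beta> * (?m * q s t) + \<epsilon> * zeta q" using \<mu> nn \<open>0 \<le> \<beta>\<close> by simp
    finally show ?thesis .
  qed
qed

lemma zeta_le_flow:
  assumes "D \<noteq> {}" "D \<noteq> UNIV"
  shows "zeta q \<le> flow (stat_dist q) q D (- D)"
  unfolding zeta_def flow_def by (rule Min_le) (use assms in auto)

text \<open>With two or more states the minimum is attained at an actual cut, and a positive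
  transition crosses it.\<close>

lemma zeta_pos:
  fixes q :: "'a::finite \<Rightarrow> 'a \<Rightarrow> real"
  assumes q: "trans_matrix q" "cut_connected q" and card: "CARD('a) \<ge> 2"
  shows "0 < zeta q"
proof -
  let ?\<C> = "{C :: 'a set. C \<noteq> {} \<and> C \<noteq> UNIV}"
  have "?\<C> \<noteq> {}"
  proof -
    obtain x :: 'a where True by simp
    have "{x} \<noteq> UNIV"
      using card by (metis One_nat_def card_1_singleton_iff numeral_le_one_iff semiring_norm(69))
    then show ?thesis by blast
  qed
  then have "zeta q \<in> (\<lambda>C. flow (stat_dist q) q C (- C)) ` ?\<C>"
    unfolding zeta_def flow_def by (intro Min_in) auto
  then obtain D where D: "D \<noteq> {}" "D \<noteq> UNIV" "zeta q = flow (stat_dist q) q D (- D)" by auto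
  obtain s t where st: "s \<in> D" "t \<in> - D" "0 < q s t"
    using q(2) D(1,2) unfolding cut_connected_def by blast
  have \<mu>: "0 < stat_dist q s" for s by (rule stationary_pos[OF q stationary_stat_dist[OF q]])
  have "0 < qset q (- D) s"
    unfolding qset_def by (rule sum_pos2[where i = t]) (use st in \<open>auto simp: trans_matrix_nonneg[OF q(1)]\<close>)
  then have "0 < flow (stat_dist q) q D (- D)"
    unfolding flow_def
    by (intro sum_pos2[where i = s])
      (auto simp: st(1) \<mu> qset_def trans_matrix_nonneg[OF q(1)] less_imp_le intro!: mult_nonneg_nonneg sum_nonneg)
  then show ?thesis using D(3) by simp
qed

text \<open>The summand \<open>n = 1\<close> alone equals \<open>|S|\<close>.\<close>

lemma Lconst_ge_card:
  assumes "CARD('a::finite) \<ge> 2"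
  shows "real CARD('a) \<le> Lconst TYPE('a)"
proof -
  have "real (CARD('a) choose 1) * real 1 ^ CARD('a) \<le> Lconst TYPE('a)"
    unfolding Lconst_def by (rule member_le_sum) (use assms in auto)
  then show ?thesis by simp
qed

text \<open>Bernoulli gives \<open>(1 - \<gamma>) ^ N \<ge> 7 / 16\<close>, and
  \<open>(1 + \<gamma>) * (1 - \<gamma>) \<le> 1\<close> then bounds the power by
  \<open>(16 / 7)^2 < 8\<close>. The factor \<open>9 / 8\<close> makes room for the additive part of
  \<open>\<gamma>\<close>; 8 is the value of \<open>2 * |S|^2\<close> for two states.\<close>

lemma perturbation_factor_power_le:
  fixes \<gamma> :: real
  assumes "2 \<le> N" and "0 \<le> \<gamma>" "\<gamma> \<le> 9 / 8 * (1 / 2 ^ N)"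
  shows "((1 + \<gamma>) / (1 - \<gamma>)) ^ N \<le> 8" and "\<gamma> < 1"
proof -
  have "2 * N \<le> 2 ^ N" using \<open>2 \<le> N\<close>
    by (induction N rule: dec_induct) auto
  then have "2 * real N \<le> 2 ^ N" by (metis of_nat_le_iff of_nat_mult of_nat_numeral of_nat_power)
  then have "real N * (1 / 2 ^ N) \<le> 1 / 2" by (simp add: field_simps)
  moreover have "real N * \<gamma> \<le> 9 / 8 * (real N * (1 / 2 ^ N))"
    using mult_left_mono[OF assms(3), of "real N"] by (simp add: mult.commute)
  ultimately have N\<gamma>: "real N * \<gamma> \<le> 9 / 16" by linarith
  have "2 * \<gamma> \<le> real N * \<gamma>" using assms(1,2) by (intro mult_right_mono) auto
  then show "\<gamma> < 1" using N\<gamma> by linarith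
  have lo: "7 / 16 \<le> (1 - \<gamma>) ^ N"
    using Bernoulli_inequality[of "- \<gamma>" N] \<open>\<gamma> < 1\<close> N\<gamma> by simp
  have "(1 + \<gamma>) ^ N * (1 - \<gamma>) ^ N = (1 - \<gamma>\<^sup>2) ^ N"
    by (simp add: power2_eq_square algebra_simps flip: power_mult_distrib)
  also have "\<dots> \<le> 1" by (rule power_le_one) (use assms(2) \<open>\<gamma> < 1\<close> in \<open>auto simp: power_le_one\<close>)
  finally have up: "(1 + \<gamma>) ^ N * (1 - \<gamma>) ^ N \<le> 1" .
  have "0 < (1 - \<gamma>) ^ N" using \<open>\<gamma> < 1\<close> by simp
  have "8 * ((1 - \<gamma>) ^ N * (1 - \<gamma>) ^ N) \<ge> 8 * (7 / 16 * (7 / 16))"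
    by (intro mult_left_mono mult_mono lo) (use \<open>\<gamma> < 1\<close> in auto)
  then have "(1 + \<gamma>) ^ N * (1 - \<gamma>) ^ N \<le> (8 * (1 - \<gamma>) ^ N) * (1 - \<gamma>) ^ N"
    using up by simp
  then have "(1 + \<gamma>) ^ N \<le> 8 * (1 - \<gamma>) ^ N"
    using \<open>0 < (1 - \<gamma>) ^ N\<close> by (rule mult_right_le_imp_le)
  then show "((1 + \<gamma>) / (1 - \<gamma>)) ^ N \<le> 8"
    using \<open>0 < (1 - \<gamma>) ^ N\<close> by (simp add: power_divide pos_divide_le_eq)
qed

section \<open>Fitting the constants and conclusion\<close>

theorem theorem3:
  fixes q qh :: "'a::finite \<Rightarrow> 'a \<Rightarrow> real" and \<epsilon> \<beta> :: real
  assumes "CARD('a) \<ge> 2"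
    and "0 < \<beta>" and "\<beta> < 1 / 2 ^ CARD('a)"
    and "0 < \<epsilon>" and "\<epsilon> < \<beta> * (1 - \<beta>) / (Lconst TYPE('a) * real (CARD('a)) ^ 4)"
    and "trans_matrix q" and "irreducible_tm q"
    and "trans_matrix qh" and "close \<epsilon> \<beta> q qh"
  shows "\<forall>C::'a set. C \<noteq> {} \<and> C \<noteq> UNIV \<longrightarrow>
     (\<forall>s\<in>C. Max ((\<lambda>t. \<bar>exitQ q s t C - exitQ qh s t C\<bar>) ` (- C)) < 12 * \<beta> * Lconst TYPE('a)) \<and>
     (let c = 2 * real (CARD('a)) ^ 2 in
        Kvisit q C / c \<le> Kvisit qh C \<and> Kvisit qh C \<le> c * Kvisit q C)"
proof (intro allI impI)
  fix C :: "'a set" assume "C \<noteq> {} \<and> C \<noteq> UNIV"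
  then have C: "C \<noteq> {}" "C \<noteq> UNIV" by auto
  define N where "N = real CARD('a)"
  define L where "L = Lconst TYPE('a)"
  define \<mu> where "\<mu> = stat_dist q"
  define z where "z = zeta q"
  define \<gamma> where "\<gamma> = \<beta> + N\<^sup>2 * \<epsilon>"
  define \<rho> where "\<rho> = (1 + \<gamma>) / (1 - \<gamma>)"
  note q = \<open>trans_matrix q\<close> and qh = \<open>trans_matrix qh\<close>
  have cut: "cut_connected q" by (rule irreducible_imp_cut_connected[OF q assms(7)])
  have st: "stationary q \<mu>" unfolding \<mu>_def by (rule stationary_stat_dist[OF q cut])
  have \<mu>: "0 < \<mu> s" for s by (rule stationary_pos[OF q cut st])
  have z: "0 < z" unfolding z_def by (rule zeta_pos[OF q cut assms(1)])
  have z_le: "z \<le> flow \<mu> q D (- D)" if "D \<noteq> {}" "D \<noteq> UNIV" for D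
    unfolding z_def \<mu>_def by (rule zeta_le_flow[OF that])
  have N: "2 \<le> N" using assms(1) by (simp add: N_def)
  have LN: "N \<le> L" unfolding N_def L_def by (rule Lconst_ge_card[OF assms(1)])
  have \<epsilon>_le: "\<epsilon> * (L * N ^ 4) \<le> \<beta>"
  proof -
    have "0 < L * N ^ 4" using N LN by simp
    then have "\<epsilon> * (L * N ^ 4) \<le> \<beta> * (1 - \<beta>)"
      using assms(5) unfolding L_def[symmetric] N_def[symmetric] by (simp add: pos_less_divide_eq)
    also have "\<dots> \<le> \<beta>" using assms(2) by (simp add: algebra_simps)
    finally show ?thesis .
  qed
  \<comment> \<open>From \<open>8 \<le> L * N^2\<close> the bound on \<open>\<epsilon>\<close> gives
    \<open>N^2 * \<epsilon> \<le> \<beta> / 8\<close>, the origin of the factor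
    \<open>9 / 8\<close>.\<close>
  have "2 * 2\<^sup>2 \<le> L * N\<^sup>2" using N LN by (intro mult_mono power_mono) auto
  then have "N\<^sup>2 * \<epsilon> * 8 \<le> N\<^sup>2 * \<epsilon> * (L * N\<^sup>2)"
    using assms(4) by (intro mult_left_mono) auto
  also have "\<dots> = \<epsilon> * (L * N ^ 4)" by (simp add: power2_eq_square power4_eq_xxxx)
  finally have "\<gamma> \<le> 9 / 8 * \<beta>" using \<epsilon>_le by (simp add: \<gamma>_def)
  then have \<gamma>_le: "\<gamma> \<le> 9 / 8 * (1 / 2 ^ CARD('a))" using assms(3) by linarith
  have \<gamma>: "0 \<le> \<gamma>" using assms(2,4) by (simp add: \<gamma>_def)
  note \<rho>8 = perturbation_factor_power_le(1)[OF assms(1) \<gamma> \<gamma>_le, folded \<rho>_def]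
  note \<gamma>1 = perturbation_factor_power_le(2)[OF assms(1) \<gamma> \<gamma>_le]
  have \<rho>: "1 \<le> \<rho>" using \<gamma> \<gamma>1 by (simp add: \<rho>_def)
  have near: "\<mu> s * \<bar>qh s t - q s t\<bar> \<le> \<beta> * (\<mu> s * q s t) + \<epsilon> * z" for s t
    unfolding \<mu>_def z_def
    by (rule close_imp_near[OF q qh assms(9)])
      (use \<mu>[of s] z assms(2,4) in \<open>auto simp: \<mu>_def z_def\<close>)
  \<comment> \<open>Unchanged rows have zero error, so every mixed matrix of the row-by-row
    replacement satisfies the same estimate and hence the same cut balance.\<close>
  have near': "\<mu> s * \<bar>(if s \<in> A then qh s else q s) t - q s t\<bar> \<le> \<beta> * (\<mu> s * q s t) + \<epsilon> * z" for A s t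
  proof (cases "s \<in> A")
    case False
    have "0 \<le> \<beta> * (\<mu> s * q s t) + \<epsilon> * z"
      using z assms(2,4) \<mu>[of s] trans_matrix_nonneg[OF q, of s t] by simp
    then show ?thesis using False by simp
  qed (use near in simp)
  have pert: "cut_balanced \<mu> r \<rho> z"
      "flow \<mu> r C (- C) \<le> \<rho> * flow \<mu> q C (- C)" "flow \<mu> q C (- C) \<le> \<rho> * flow \<mu> r C (- C)"
    if r: "\<And>s t. \<mu> s * \<bar>r s t - q s t\<bar> \<le> \<beta> * (\<mu> s * q s t) + \<epsilon> * z" for r
    by (rule cut_balanced_perturbation[OF q st r z _ less_imp_le[OF assms(4)]
      \<gamma>_def[unfolded N_def] \<gamma> \<gamma>1 \<rho>_def]; simp add: z_le C)+
  have exit: "\<bar>exitQ q s t C - exitQ qh s t C\<bar> < 12 * \<beta> * L" for s t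
  proof -
    let ?R = "\<rho> ^ (CARD('a) - 1) * real (CARD('a) - 1) * \<epsilon>"
    have "\<bar>exitQ qh s t C - exitQ q s t C\<bar> \<le> real (card C) * (\<beta> + real CARD('a) * ?R)"
      by (rule exitQ_perturbation[OF q qh C(2) \<mu> z \<rho> _ _ near pert(1)[OF near']])
        (use assms(2,4) in auto)
    also have "\<dots> \<le> N * (\<beta> + N * (8 * N * \<epsilon>))"
    proof (intro mult_mono add_left_mono)
      have "\<rho> ^ (CARD('a) - 1) \<le> \<rho> ^ CARD('a)" by (rule power_increasing[OF _ \<rho>]) simp
      then show "\<rho> ^ (CARD('a) - 1) \<le> 8" using \<rho>8 by linarith
    qed (use \<rho> assms(2,4) in \<open>auto simp: N_def card_mono\<close>)
    also have "\<dots> = N * \<beta> + 2 * (\<epsilon> * (4 * N ^ 3))" by (simp add: power3_eq_cube algebra_simps)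
    \<comment> \<open>As \<open>4 \<le> L * N\<close>, the additive part costs at most
      \<open>2 * \<beta>\<close>; with \<open>2 \<le> N \<le> L\<close> the total is at most
      \<open>2 * \<beta> * L\<close>.\<close>
    also have "\<epsilon> * (4 * N ^ 3) \<le> \<epsilon> * ((L * N) * N ^ 3)"
    proof (intro mult_left_mono mult_right_mono)
      have "2 * 2 \<le> L * N" using N LN by (intro mult_mono) auto
      then show "4 \<le> L * N" by simp
    qed (use N assms(4) in auto)
    also have "\<dots> = \<epsilon> * (L * N ^ 4)" by (simp add: power3_eq_cube power4_eq_xxxx)
    also have "N * \<beta> + 2 * (\<epsilon> * (L * N ^ 4)) \<le> L * \<beta> + L * \<beta>"
      using \<epsilon>_le N LN assms(2) mult_right_mono[of N L \<beta>] mult_right_mono[of 2 L \<beta>] by linarith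
    also have "\<dots> < 12 * \<beta> * L" using N LN assms(2) by simp
    finally show ?thesis by (simp add: abs_minus_commute)
  qed
  have K: "Kvisit qh C \<le> \<rho> ^ CARD('a) * Kvisit q C" "Kvisit q C \<le> \<rho> ^ CARD('a) * Kvisit qh C"
  proof -
    have "0 < flow \<mu> q C (- C)" using z z_le[OF C] by linarith
    note * = Kvisit_perturbation[OF q cut qh pert(1)[OF near, unfolded \<mu>_def] z \<rho> C
        this[unfolded \<mu>_def] pert(2)[OF near, unfolded \<mu>_def] pert(3)[OF near, unfolded \<mu>_def]]
    show "Kvisit qh C \<le> \<rho> ^ CARD('a) * Kvisit q C" "Kvisit q C \<le> \<rho> ^ CARD('a) * Kvisit qh C"
      by (fact *)+
  qed
  have \<rho>c: "\<rho> ^ CARD('a) \<le> 2 * N\<^sup>2"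
  proof -
    have "2\<^sup>2 \<le> N\<^sup>2" using N by (intro power_mono) auto
    then show ?thesis using \<rho>8 by simp
  qed
  \<comment> \<open>Enlarging \<open>\<rho> ^ CARD('a)\<close> to \<open>2 * N^2\<close> requires
    nonnegative visit lengths; for \<open>qh\<close> this is inherited from \<open>q\<close> through
    the comparison \<open>K(2)\<close>.\<close>
  have K_nonneg: "0 \<le> Kvisit q C" "0 \<le> Kvisit qh C"
  proof -
    have 1: "1 \<le> \<rho> ^ CARD('a)" using \<rho> by (rule one_le_power)
    show "0 \<le> Kvisit q C"
      unfolding Kvisit_eq[OF q cut C(2)] using z z_le[OF C] \<mu>
      by (simp add: \<mu>_def sum_nonneg less_imp_le)
    then have "0 \<le> \<rho> ^ CARD('a) * Kvisit qh C" using K(2) by linarith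
    then show "0 \<le> Kvisit qh C" using 1 by (simp add: zero_le_mult_iff)
  qed
  have K1: "Kvisit qh C \<le> 2 * N\<^sup>2 * Kvisit q C"
    using K(1) mult_right_mono[OF \<rho>c K_nonneg(1)] by linarith
  have "Kvisit q C \<le> 2 * N\<^sup>2 * Kvisit qh C"
    using K(2) mult_right_mono[OF \<rho>c K_nonneg(2)] by linarith
  then have K2: "Kvisit q C / (2 * N\<^sup>2) \<le> Kvisit qh C"
    using N by (simp add: divide_le_eq mult.commute)
  have "Max ((\<lambda>t. \<bar>exitQ q s t C - exitQ qh s t C\<bar>) ` (- C)) < 12 * \<beta> * L" for s
    using C by (subst Max_less_iff) (auto simp: exit)
  then show "(\<forall>s\<in>C. Max ((\<lambda>t. \<bar>exitQ q s t C - exitQ qh s t C\<bar>) ` (- C)) < 12 * \<beta> * Lconst TYPE('a)) \<and>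
     (let c = 2 * real (CARD('a)) ^ 2 in
        Kvisit q C / c \<le> Kvisit qh C \<and> Kvisit qh C \<le> c * Kvisit q C)"
    using K1 K2 by (simp add: Let_def N_def L_def)
qed

end
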